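(* Let $G$ be a directed graph in which the in-degree of each vertex is finite and at least $2$. Let $\mathcal{G}$ be the topological groupoid of $G$ constructed from right-infinite paths, and let $\mathsf{B}(\mathcal{G})$ be its ample semigroup, i.e. the inverse semigroup of all compact-open bisections of $\mathcal{G}$ under multiplication of subsets. Then the Cuntz-Krieger semigroup $CK_G$ is isomorphic to $\mathsf{B}(\mathcal{G})$.
   Context: Graph inverse semigroup: a directed graph $G$ has vertices $G_0$, edges $G_1$ and maps $\mathbf{d},\mathbf{r}\colon G_1\to G_0$. The in-degree of a vertex $v$ is the number of edges $x$ with $\mathbf{r}(x)=v$. A (finite) path is an empty path $1_v$ at a vertex $v$ or a sequence of edges $x_1\cdots x_n$ with $\mathbf{d}(x_i)=\mathbf{r}(x_{i+1})$; its range is $\mathbf{r}(x_1)$ and its domain is $\mathbf{d}(x_n)$ (both $v$ for $1_v$), and $|x|$ is its number of edges. $G^{*}$ is the set of finite paths under concatenation ($xy$ defined iff $\mathbf{d}(x)=\mathbf{r}(y)$). $P_G$ consists of $0$ and formal elements $xy^{-1}$ with $x,y\in G^{*}$, $\mathbf{d}(x)=\mathbf{d}(y)$, with product $xy^{-1}\cdot uv^{-1}=xzv^{-1}$ if $u=yz$; $=x(vz)^{-1}$ if $y=uz$; $=0$ otherwise. Any two elements of $P_G$ have a meet $\wedge$ for the natural partial order $\le$. Construction of $CK_G$: elements $s,t$ of an inverse semigroup are compatible if $s^{-1}t$, $st^{-1}$ are idempotents, orthogonal if $s^{-1}t=0=st^{-1}$. For a subset $A$ of $P_G$, $A^{\downarrow}$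 is the set of elements lying below some element of $A$. $\mathsf{D}(P_G)$ is the set of all $\{s_1,\dots,s_m\}^{\downarrow}$ ($m\ge1$) with the $s_i$ pairwise compatible, under multiplication of subsets; it is an inverse semigroup. Each nonzero $X\in\mathsf{D}(P_G)$ equals $A_X^{\downarrow}$ for a unique finite set $A_X$ of pairwise orthogonal nonzero elements. For finite subsets write $\{a_1,\dots,a_m\}\to\{b_1,\dots,b_n\}$ if for every $i$ and every nonzero $x\le a_i$ there is $j$ with $x\wedge b_j\neq0$; write $A\leftrightarrow B$ if $A\to B$ and $B\to A$. Define $X\equiv Y$ iff $A_X\leftrightarrow A_Y$ for nonzero $X,Y$, and $\{0\}\equiv\{0\}$ only. This is a congruence, and $CK_G=\mathsf{D}(P_G)/\!\equiv$. The groupoid $\mathcal{G}$: $G^{\omega}$ is the set of right-infinite paths $w=w_1w_2w_3\cdots$ of edges with $\mathbf{d}(w_i)=\mathbf{r}(w_{i+1})$. If $w=uw'$ with $u$ a finite path and $w'\in G^\omega$, write $u^{-1}w=w'$. The elements of $\mathcal{G}$ are the triples $(w,k,w')\in G^{\omega}\times\mathbb{Z}\times G^{\omega}$ for which there are finite paths $u,v$ with $u^{-1}w=v^{-1}w'$ (both defined) and $|v|-|u|=k$. The product is $(w,k,w')(w',l,w'')=(w,k+l,w'')$ and $(w,k,w')^{-1}=(w',-k,w)$. A basis for the topology is given by the sets $Z(x,y)$, for $x,y\in G^{*}$ with $\mathbf{d}(x)=\mathbf{d}(y)$, where $Z(x,y)$ consists of all $(w,k,w')\in\mathcal{G}$ with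 $x^{-1}w=y^{-1}w'$ (both defined) and $k=|y|-|x|$. A bisection is a subset of $\mathcal{G}$ on which the domain and range maps are injective. *)

theory Defs
  imports
    "Graph_Theory.Digraph"
    "HOL-Library.Omega_Words_Fun"
    "HOL-Analysis.Function_Topology"
begin

section \<open>Finite and right-infinite paths\<close>

text \<open>
  For an edge \<open>e\<close> of \<open>G\<close>, the domain \<open>d(e)\<close> is \<open>tail G e\<close> and the range \<open>r(e)\<close> is
  \<open>head G e\<close>, so that \<open>in_degree G v\<close> counts the edges with range \<open>v\<close>.
  A path \<open>x\<^sub>1 \<dots> x\<^sub>n\<close> satisfies \<open>d(x\<^sub>i) = r(x\<^sub>i\<^sub>+\<^sub>1)\<close>, that is, it is written against the direction
  of the edges (and so is not an \<open>awalk\<close>). It is represented by the pair of its range and its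
  list of edges; the empty path at \<open>v\<close> is \<open>(v, [])\<close>.
\<close>

type_synonym ('v, 'e) fpath = "'v \<times> 'e list"

definition fpaths :: "('v, 'e) pre_digraph \<Rightarrow> ('v, 'e) fpath set" where
  "fpaths G = {(v, es). v \<in> verts G \<and> set es \<subseteq> arcs G \<and>
     (es \<noteq> [] \<longrightarrow> head G (hd es) = v) \<and>
     successively (\<lambda>e f. tail G e = head G f) es}"

definition prange :: "('v, 'e) fpath \<Rightarrow> 'v" where
  "prange x = fst x"

definition pdom :: "('v, 'e) pre_digraph \<Rightarrow> ('v, 'e) fpath \<Rightarrow> 'v" where
  "pdom G x = (if snd x = [] then fst x else tail G (last (snd x)))"

definition plen :: "('v, 'e) fpath \<Rightarrow> nat" where
  "plen x = length (snd x)"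

text \<open>Concatenation is meaningful only when the domain of \<open>x\<close> is the range of \<open>y\<close>.\<close>

definition pconc :: "('v, 'e) fpath \<Rightarrow> ('v, 'e) fpath \<Rightarrow> ('v, 'e) fpath" where
  "pconc x y = (fst x, snd x @ snd y)"

text \<open>\<open>pfactor G u y z\<close> says that \<open>u = yz\<close> in the category of paths.\<close>

definition pfactor ::
  "('v, 'e) pre_digraph \<Rightarrow> ('v, 'e) fpath \<Rightarrow> ('v, 'e) fpath \<Rightarrow> ('v, 'e) fpath \<Rightarrow> bool" where
  "pfactor G u y z \<longleftrightarrow> z \<in> fpaths G \<and> pdom G y = prange z \<and> u = pconc y z"

definition ipaths :: "('v, 'e) pre_digraph \<Rightarrow> (nat \<Rightarrow> 'e) set" where
  "ipaths G = {w. range w \<subseteq> arcs G \<and> (\<forall>i. tail G (w i) = head G (w (Suc i)))}"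

text \<open>\<open>ifactor G w u t\<close> says that \<open>w = ut\<close>, i.e. that \<open>u\<^sup>-\<^sup>1w\<close> is defined and equal to \<open>t\<close>.\<close>

definition ifactor ::
  "('v, 'e) pre_digraph \<Rightarrow> (nat \<Rightarrow> 'e) \<Rightarrow> ('v, 'e) fpath \<Rightarrow> (nat \<Rightarrow> 'e) \<Rightarrow> bool" where
  "ifactor G w u t \<longleftrightarrow>
     u \<in> fpaths G \<and> w \<in> ipaths G \<and> t \<in> ipaths G \<and> pdom G u = head G (t 0) \<and> w = snd u \<frown> t"


section \<open>The graph inverse semigroup\<close>

text \<open>\<open>Elem x y\<close> stands for \<open>xy\<^sup>-\<^sup>1\<close>.\<close>

datatype 'p gis = Zero | Elem 'p 'p

definition PG :: "('v, 'e) pre_digraph \<Rightarrow> ('v, 'e) fpath gis set" where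
  "PG G = insert Zero {Elem x y | x y. x \<in> fpaths G \<and> y \<in> fpaths G \<and> pdom G x = pdom G y}"

text \<open>The factor \<open>z\<close> is unique when it exists; if both \<open>u = yz\<close> and \<open>y = uz'\<close> then \<open>y = u\<close> and
  the two nonzero cases agree.\<close>

fun gmult ::
  "('v, 'e) pre_digraph \<Rightarrow> ('v, 'e) fpath gis \<Rightarrow> ('v, 'e) fpath gis \<Rightarrow> ('v, 'e) fpath gis" where
  "gmult G (Elem x y) (Elem u v) =
     (if \<exists>z. pfactor G u y z then Elem (pconc x (THE z. pfactor G u y z)) v
      else if \<exists>z. pfactor G y u z then Elem x (pconc v (THE z. pfactor G y u z))
      else Zero)"
| "gmult G _ _ = Zero"

fun ginv :: "'p gis \<Rightarrow> 'p gis" where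
  "ginv Zero = Zero"
| "ginv (Elem x y) = Elem y x"

definition gidem :: "('v, 'e) pre_digraph \<Rightarrow> ('v, 'e) fpath gis \<Rightarrow> bool" where
  "gidem G e \<longleftrightarrow> e \<in> PG G \<and> gmult G e e = e"

definition gle :: "('v, 'e) pre_digraph \<Rightarrow> ('v, 'e) fpath gis \<Rightarrow> ('v, 'e) fpath gis \<Rightarrow> bool" where
  "gle G s t \<longleftrightarrow> s \<in> PG G \<and> t \<in> PG G \<and> (\<exists>e. gidem G e \<and> s = gmult G t e)"

definition gmeet ::
  "('v, 'e) pre_digraph \<Rightarrow> ('v, 'e) fpath gis \<Rightarrow> ('v, 'e) fpath gis \<Rightarrow> ('v, 'e) fpath gis" where
  "gmeet G s t = (THE m. gle G m s \<and> gle G m t \<and> (\<forall>z. gle G z s \<and> gle G z t \<longrightarrow> gle G z m))"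

definition compatible ::
  "('v, 'e) pre_digraph \<Rightarrow> ('v, 'e) fpath gis \<Rightarrow> ('v, 'e) fpath gis \<Rightarrow> bool" where
  "compatible G s t \<longleftrightarrow> gidem G (gmult G (ginv s) t) \<and> gidem G (gmult G s (ginv t))"

definition orthogonal ::
  "('v, 'e) pre_digraph \<Rightarrow> ('v, 'e) fpath gis \<Rightarrow> ('v, 'e) fpath gis \<Rightarrow> bool" where
  "orthogonal G s t \<longleftrightarrow> gmult G (ginv s) t = Zero \<and> gmult G s (ginv t) = Zero"


section \<open>The Cuntz-Krieger semigroup\<close>

definition down_closure ::
  "('v, 'e) pre_digraph \<Rightarrow> ('v, 'e) fpath gis set \<Rightarrow> ('v, 'e) fpath gis set" where
  "down_closure G A = {s. \<exists>a\<in>A. gle G s a}"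

definition DP :: "('v, 'e) pre_digraph \<Rightarrow> ('v, 'e) fpath gis set set" where
  "DP G = {down_closure G S | S. S \<subseteq> PG G \<and> finite S \<and> S \<noteq> {} \<and>
     (\<forall>s\<in>S. \<forall>t\<in>S. compatible G s t)}"

definition DP_mult ::
  "('v, 'e) pre_digraph \<Rightarrow> ('v, 'e) fpath gis set \<Rightarrow> ('v, 'e) fpath gis set
     \<Rightarrow> ('v, 'e) fpath gis set" where
  "DP_mult G X Y = {gmult G s t | s t. s \<in> X \<and> t \<in> Y}"

text \<open>The set \<open>A\<^sub>X\<close>, for \<open>X \<in> DP G\<close> different from \<open>{Zero}\<close>, the zero of \<open>DP G\<close>.\<close>

definition orth_gens ::
  "('v, 'e) pre_digraph \<Rightarrow> ('v, 'e) fpath gis set \<Rightarrow> ('v, 'e) fpath gis set" where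
  "orth_gens G X = (THE A. finite A \<and> A \<subseteq> PG G - {Zero} \<and>
     pairwise (orthogonal G) A \<and> X = down_closure G A)"

definition arrow ::
  "('v, 'e) pre_digraph \<Rightarrow> ('v, 'e) fpath gis set \<Rightarrow> ('v, 'e) fpath gis set \<Rightarrow> bool" where
  "arrow G A B \<longleftrightarrow> (\<forall>a\<in>A. \<forall>x. x \<noteq> Zero \<and> gle G x a \<longrightarrow> (\<exists>b\<in>B. gmeet G x b \<noteq> Zero))"

definition CK_rel ::
  "('v, 'e) pre_digraph \<Rightarrow> (('v, 'e) fpath gis set \<times> ('v, 'e) fpath gis set) set" where
  "CK_rel G = {(X, Y). X \<in> DP G \<and> Y \<in> DP G \<and>
     (X = {Zero} \<and> Y = {Zero} \<or>
      X \<noteq> {Zero} \<and> Y \<noteq> {Zero} \<and>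
      arrow G (orth_gens G X) (orth_gens G Y) \<and> arrow G (orth_gens G Y) (orth_gens G X))}"

definition CK :: "('v, 'e) pre_digraph \<Rightarrow> ('v, 'e) fpath gis set set set" where
  "CK G = DP G // CK_rel G"

definition CK_mult ::
  "('v, 'e) pre_digraph \<Rightarrow> ('v, 'e) fpath gis set set \<Rightarrow> ('v, 'e) fpath gis set set
     \<Rightarrow> ('v, 'e) fpath gis set set" where
  "CK_mult G C C' = (\<Union>X\<in>C. \<Union>Y\<in>C'. CK_rel G `` {DP_mult G X Y})"


section \<open>The path groupoid and its ample semigroup\<close>

type_synonym 'e gpd_elem = "(nat \<Rightarrow> 'e) \<times> int \<times> (nat \<Rightarrow> 'e)"

definition groupoid :: "('v, 'e) pre_digraph \<Rightarrow> 'e gpd_elem set" where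
  "groupoid G = {(w, k, w'). \<exists>u v t. ifactor G w u t \<and> ifactor G w' v t \<and>
     k = int (plen v) - int (plen u)}"

text \<open>The identities \<open>g\<^sup>-\<^sup>1g\<close> and \<open>gg\<^sup>-\<^sup>1\<close>.\<close>

fun gpd_dom :: "'e gpd_elem \<Rightarrow> 'e gpd_elem" where
  "gpd_dom (w, k, w') = (w', 0, w')"

fun gpd_ran :: "'e gpd_elem \<Rightarrow> 'e gpd_elem" where
  "gpd_ran (w, k, w') = (w, 0, w)"

definition gpd_set_mult :: "'e gpd_elem set \<Rightarrow> 'e gpd_elem set \<Rightarrow> 'e gpd_elem set" where
  "gpd_set_mult A B =
     {(w, k + l, w'') | w k w' l w''. (w, k, w') \<in> A \<and> (w', l, w'') \<in> B}"

definition Zset ::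
  "('v, 'e) pre_digraph \<Rightarrow> ('v, 'e) fpath \<Rightarrow> ('v, 'e) fpath \<Rightarrow> 'e gpd_elem set" where
  "Zset G x y = {(w, k, w') \<in> groupoid G. \<exists>t. ifactor G w x t \<and> ifactor G w' y t \<and>
     k = int (plen y) - int (plen x)}"

definition Zbasis :: "('v, 'e) pre_digraph \<Rightarrow> 'e gpd_elem set set" where
  "Zbasis G = {Zset G x y | x y. x \<in> fpaths G \<and> y \<in> fpaths G \<and> pdom G x = pdom G y}"

text \<open>\<open>topology_generated_by\<close> takes a subbasis; lemma \<open>openin_groupoid_topology\<close> below shows that
  \<open>Zbasis G\<close> is in fact a basis.\<close>

definition groupoid_topology :: "('v, 'e) pre_digraph \<Rightarrow> 'e gpd_elem topology" where
  "groupoid_topology G = topology_generated_by (Zbasis G)"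

definition bisection :: "('v, 'e) pre_digraph \<Rightarrow> 'e gpd_elem set \<Rightarrow> bool" where
  "bisection G A \<longleftrightarrow> A \<subseteq> groupoid G \<and> inj_on gpd_dom A \<and> inj_on gpd_ran A"

definition ample_semigroup :: "('v, 'e) pre_digraph \<Rightarrow> 'e gpd_elem set set" where
  "ample_semigroup G = {A. bisection G A \<and>
     openin (groupoid_topology G) A \<and> compactin (groupoid_topology G) A}"


section \<open>Isomorphism of semigroups given by a carrier and a product\<close>

definition semigroup_isomorphic ::
  "'a set \<Rightarrow> ('a \<Rightarrow> 'a \<Rightarrow> 'a) \<Rightarrow> 'b set \<Rightarrow> ('b \<Rightarrow> 'b \<Rightarrow> 'b) \<Rightarrow> bool" where
  "semigroup_isomorphic S f T g \<longleftrightarrow>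
     (\<exists>\<phi>. bij_betw \<phi> S T \<and> (\<forall>a\<in>S. \<forall>b\<in>S. \<phi> (f a b) = g (\<phi> a) (\<phi> b)))"


section \<open>The sets \<open>Zset G x y\<close> form a basis\<close>

lemma ifactor_iff:
  "ifactor G w u t \<longleftrightarrow>
     u \<in> fpaths G \<and> w \<in> ipaths G \<and> fst u = head G (w 0) \<and> w = snd u \<frown> t"
proof
  assume a: "ifactor G w u t"
  show "u \<in> fpaths G \<and> w \<in> ipaths G \<and> fst u = head G (w 0) \<and> w = snd u \<frown> t"
  proof (cases "snd u")
    case Nil
    with a show ?thesis by (auto simp: ifactor_def pdom_def)
  next
    case (Cons e es)
    with a show ?thesis by (cases u) (auto simp: ifactor_def fpaths_def)
  qed
next
  assume a: "u \<in> fpaths G \<and> w \<in> ipaths G \<and> fst u = head G (w 0) \<and> w = snd u \<frown> t"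
  have ti: "t i = w (length (snd u) + i)" for i using a by simp
  have w: "w \<in> ipaths G" using a by blast
  then have "t \<in> ipaths G" by (auto simp: ipaths_def ti)
  moreover have "pdom G u = head G (t 0)"
  proof (cases "snd u = []")
    case True
    with a show ?thesis by (simp add: pdom_def)
  next
    case False
    then obtain n where n: "length (snd u) = Suc n" by (cases "snd u") auto
    have "last (snd u) = w n" using a n False by (simp add: last_conv_nth)
    moreover have "tail G (w n) = head G (w (Suc n))" using w unfolding ipaths_def by blast
    moreover have "t 0 = w (Suc n)" using ti[of 0] n by simp
    ultimately show ?thesis using False by (simp add: pdom_def)
  qed
  ultimately show "ifactor G w u t" using a unfolding ifactor_def by blast
qed

lemma ifactor_split:
  assumes "ifactor G w x t" "ifactor G w u t'" "plen x \<le> plen u"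
  shows "\<exists>p. snd u = snd x @ p \<and> t = p \<frown> t' \<and> fst u = fst x"
proof -
  have "w = snd x \<frown> t" "w = snd u \<frown> t'" "fst u = fst x"
    using assms by (auto simp: ifactor_iff)
  then have eq: "(if i < length (snd x) then snd x ! i else t (i - length (snd x)))
      = (if i < length (snd u) then snd u ! i else t' (i - length (snd u)))" for i
    unfolding conc_def by meson
  define p where "p = drop (length (snd x)) (snd u)"
  have le: "length (snd x) \<le> length (snd u)" using assms(3) by (simp add: plen_def)
  have "take (length (snd x)) (snd u) = snd x"
  proof (rule nth_equalityI)
    show "length (take (length (snd x)) (snd u)) = length (snd x)" using le by simp
  next
    fix i assume "i < length (take (length (snd x)) (snd u))"
    then show "take (length (snd x)) (snd u) ! i = snd x ! i" using eq[of i] by auto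
  qed
  then have u: "snd u = snd x @ p" unfolding p_def by (metis append_take_drop_id)
  have "t i = (p \<frown> t') i" for i
    using eq[of "length (snd x) + i"] u by (auto simp: nth_append)
  then show ?thesis using u \<open>fst u = fst x\<close> by blast
qed

lemma Zset_subset:
  assumes "g \<in> Zset G x y" "g \<in> Zset G u v" "plen x \<le> plen u"
    and "x \<in> fpaths G" "y \<in> fpaths G"
  shows "Zset G u v \<subseteq> Zset G x y"
proof -
  obtain w k w' t t' where
    t: "ifactor G w x t" "ifactor G w' y t" "k = int (plen y) - int (plen x)" and
    t': "ifactor G w u t'" "ifactor G w' v t'" "k = int (plen v) - int (plen u)"
    using assms(1,2) by (cases g) (auto simp: Zset_def)
  obtain p where p: "snd u = snd x @ p" "t = p \<frown> t'" "fst u = fst x"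
    using ifactor_split[OF t(1) t'(1) assms(3)] by blast
  have "plen y \<le> plen v" using t(3) t'(3) assms(3) by linarith
  then obtain q where q: "snd v = snd y @ q" "t = q \<frown> t'" "fst v = fst y"
    using ifactor_split[OF t(2) t'(2)] by blast
  have len: "length p = length q" using t(3) t'(3) p(1) q(1) by (simp add: plen_def)
  have "p = q"
  proof (rule nth_equalityI[OF len])
    fix i assume "i < length p"
    moreover have "(p \<frown> t') i = (q \<frown> t') i" using p(2) q(2) by metis
    ultimately show "p ! i = q ! i" using len by simp
  qed
  show ?thesis
  proof
    fix h assume "h \<in> Zset G u v"
    then obtain w1 k1 w2 s where h: "h = (w1, k1, w2)" "h \<in> groupoid G"
      "ifactor G w1 u s" "ifactor G w2 v s" "k1 = int (plen v) - int (plen u)"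
      by (cases h) (auto simp: Zset_def)
    have "ifactor G w1 x (p \<frown> s)" "ifactor G w2 y (p \<frown> s)"
      using h(3,4) p(1,3) q(1,3) \<open>p = q\<close> assms(4,5) by (auto simp: ifactor_iff conc_conc)
    moreover have "k1 = int (plen y) - int (plen x)" using h(5) t(3) t'(3) by simp
    ultimately show "h \<in> Zset G x y" using h(1,2) by (auto simp: Zset_def)
  qed
qed

lemma Zbasis_Int:
  assumes "A \<in> Zbasis G" "B \<in> Zbasis G"
  shows "A \<inter> B = {} \<or> A \<inter> B \<in> Zbasis G"
proof (cases "A \<inter> B = {}")
  case False
  then obtain g where g: "g \<in> A" "g \<in> B" by blast
  obtain x y u v where A: "A = Zset G x y" "x \<in> fpaths G" "y \<in> fpaths G"
    and B: "B = Zset G u v" "u \<in> fpaths G" "v \<in> fpaths G"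
    using assms by (auto simp: Zbasis_def)
  have "A \<subseteq> B \<or> B \<subseteq> A"
    using Zset_subset[of g G x y u v] Zset_subset[of g G u v x y] g A B by fastforce
  then show ?thesis using assms by (metis Int_absorb1 Int_absorb2)
qed simp

lemma openin_groupoid_topology:
  "openin (groupoid_topology G) U \<longleftrightarrow> (\<exists>F. F \<subseteq> Zbasis G \<and> U = \<Union>F)"
proof
  assume "openin (groupoid_topology G) U"
  then have "generate_topology_on (Zbasis G) U"
    by (simp add: groupoid_topology_def openin_topology_generated_by_iff)
  then show "\<exists>F. F \<subseteq> Zbasis G \<and> U = \<Union>F"
  proof induction
    case Empty
    then show ?case by auto
  next
    case (Int a b)
    then obtain E F where EF: "E \<subseteq> Zbasis G" "a = \<Union>E" "F \<subseteq> Zbasis G" "b = \<Union>F" by blast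
    let ?H = "{A \<inter> B | A B. A \<in> E \<and> B \<in> F} - {{}}"
    have "?H \<subseteq> Zbasis G" using EF Zbasis_Int by blast
    moreover have "a \<inter> b = \<Union>?H" using EF by auto
    ultimately show ?case by blast
  next
    case (UN K)
    then have "\<forall>k\<in>K. \<exists>F. F \<subseteq> Zbasis G \<and> k = \<Union>F" by blast
    then obtain F where F: "\<forall>k\<in>K. F k \<subseteq> Zbasis G \<and> k = \<Union>(F k)"
      using bchoice[of K "\<lambda>k F. F \<subseteq> Zbasis G \<and> k = \<Union>F"] by blast
    have "\<Union>(F ` K) \<subseteq> Zbasis G" using F by blast
    moreover have "\<Union>K = \<Union>(\<Union>(F ` K))" using F by (fastforce simp: set_eq_iff)
    ultimately show ?case by blast
  next
    case (Basis s)
    then show ?case by (intro exI[of _ "{s}"]) auto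
  qed
next
  assume "\<exists>F. F \<subseteq> Zbasis G \<and> U = \<Union>F"
  then show "openin (groupoid_topology G) U"
    unfolding groupoid_topology_def by (blast intro: topology_generated_by_Basis openin_Union)
qed

lemma topspace_groupoid_topology: "topspace (groupoid_topology G) = groupoid G"
proof -
  have "groupoid G \<subseteq> \<Union>(Zbasis G)"
  proof
    fix g assume g: "g \<in> groupoid G"
    then obtain w k w' u v t where uv: "g = (w, k, w')" "ifactor G w u t" "ifactor G w' v t"
      "k = int (plen v) - int (plen u)"
      by (auto simp: groupoid_def)
    then have "g \<in> Zset G u v" using g by (auto simp: Zset_def)
    moreover have "u \<in> fpaths G" "v \<in> fpaths G" "pdom G u = pdom G v"
      using uv by (auto simp: ifactor_def)
    then have "Zset G u v \<in> Zbasis G" unfolding Zbasis_def by blast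
    ultimately show "g \<in> \<Union>(Zbasis G)" by blast
  qed
  moreover have "\<Union>(Zbasis G) \<subseteq> groupoid G" by (auto simp: Zbasis_def Zset_def)
  ultimately show ?thesis
    by (simp add: groupoid_topology_def topology_generated_by_topspace subset_antisym)
qed

end

theory Submission
  imports Defs
begin

text \<open>
  An element of \<open>DP G\<close> is sent to the union of the cylinders \<open>Zset G a b\<close> over its elements
  \<open>ab\<^sup>-\<^sup>1\<close>. The nonzero elements below an element of the graph inverse semigroup form a partial
  bijection of finite paths, and the product becomes composition of relations, so that compatible
  families correspond to bisections and the map is multiplicative. Two points make it
  surjective with kernel \<open>CK_rel G\<close>: cylinders are compact because the in-degrees are finite, so
  that a compact-open bisection is a finite union of cylinders; and since every cylinder is
  nonempty and two cylinders that meet are nested, \<open>arrow G A B\<close> says exactly that the cylinders of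
  \<open>A\<close> are covered by those of \<open>B\<close>.
\<close>

section \<open>Extending finite paths\<close>

text \<open>Two obstacles shape the proof. \<open>gmult\<close> is a case distinction with a
  \<open>THE\<close> inside, so statements about several products would split into many cases; and
  \<open>arrow\<close> speaks of finite paths, while the groupoid consists of infinite ones. One
  picture serves for both: \<open>xy\<^sup>-\<^sup>1\<close> replaces the prefix \<open>y\<close> by
  \<open>x\<close>. On finite tails this is the relation \<open>below G (Elem x y)\<close>, on
  infinite tails, with the length difference recorded, it is \<open>Zset G x y\<close>. On the
  finite side, compatibility and orthogonality become statements of relation algebra. To pass
  between the sides, finitely many edges of the common infinite tail are moved into both labels
  (\<open>Zset_refine\<close>): two cylinders through one point whose first labels have equal length
  coincide. To get a covering of cylinders from \<open>arrow\<close>, labels are made longer than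
  all those of the covering set, which is where its finiteness enters. Once \<open>CK_rel G\<close>
  is known to be the kernel of \<open>zunion\<close>, its being a congruence needs no argument about
  generators: it follows from multiplicativity.\<close>

definition pext :: "('v, 'e) fpath \<Rightarrow> 'e list \<Rightarrow> ('v, 'e) fpath" where
  "pext x p = (fst x, snd x @ p)"

lemma pext_Nil [simp]: "pext x [] = x"
  by (simp add: pext_def)

lemma pext_pext [simp]: "pext (pext x p) q = pext x (p @ q)"
  by (simp add: pext_def)

lemma pext_eq_pext_iff [simp]: "pext x p = pext x q \<longleftrightarrow> p = q"
  by (auto simp: pext_def)

lemma pext_eq_self_iff [simp]: "pext x p = x \<longleftrightarrow> p = []" "x = pext x p \<longleftrightarrow> p = []"
  by (auto simp: pext_def prod_eq_iff)

lemma plen_pext [simp]: "plen (pext x p) = plen x + length p"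
  by (simp add: pext_def plen_def)

text \<open>Prefixes of one word are linearly ordered. The vanishing case of the product and the
  comparability of elements with a common nonzero lower bound rest on this.\<close>

lemma pext_eq_pextD:
  assumes "pext x p = pext u q"
  shows "(\<exists>r. x = pext u r \<and> q = r @ p) \<or> (\<exists>r. u = pext x r \<and> p = r @ q)"
  using assms by (auto simp: pext_def append_eq_append_conv2 prod_eq_iff)

lemma pext_eq_pext_lengthD:
  assumes "pext x p = pext u q" "length p = length q"
  shows "x = u"
  using assms by (auto simp: pext_def prod_eq_iff)

text \<open>The graph of prefix replacement, with the new path listed first, so that
  \<open>O\<close> composes in the same order as \<open>gmult\<close>.\<close>

definition below :: "('v, 'e) pre_digraph \<Rightarrow> ('v, 'e) fpath gis \<Rightarrow> ('v, 'e) fpath rel" where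
  "below G s = {(a, b). gle G (Elem a b) s}"

context wf_digraph
begin

section \<open>Finite paths and their extensions\<close>

lemma pdom_in_verts: "x \<in> fpaths G \<Longrightarrow> pdom G x \<in> verts G"
  using last_in_set by (fastforce simp: fpaths_def pdom_def)

lemma Nil_in_fpaths [simp]: "(v, []) \<in> fpaths G \<longleftrightarrow> v \<in> verts G"
  by (simp add: fpaths_def)

lemma Cons_in_fpaths:
  "(v, e # p) \<in> fpaths G \<longleftrightarrow> e \<in> arcs G \<and> head G e = v \<and> (tail G e, p) \<in> fpaths G"
  by (cases p) (auto simp: fpaths_def)

lemma pdom_Nil [simp]: "pdom G (v, []) = v"
  by (simp add: pdom_def)

lemma pdom_Cons [simp]: "pdom G (v, e # p) = pdom G (tail G e, p)"
  by (simp add: pdom_def)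

lemma pdom_pext: "pdom G (pext x p) = pdom G (pdom G x, p)"
  by (auto simp: pdom_def pext_def)

lemma append_in_fpaths:
  "(v, p @ q) \<in> fpaths G \<longleftrightarrow> (v, p) \<in> fpaths G \<and> (pdom G (v, p), q) \<in> fpaths G"
proof (induction p arbitrary: v)
  case Nil
  then show ?case by (auto simp: fpaths_def)
next
  case (Cons e p)
  then show ?case by (auto simp: Cons_in_fpaths)
qed

lemma pext_in_fpaths:
  "pext x p \<in> fpaths G \<longleftrightarrow> x \<in> fpaths G \<and> (pdom G x, p) \<in> fpaths G"
  using append_in_fpaths[of "fst x" "snd x" p] by (simp add: pext_def)

section \<open>The natural partial order of the graph inverse semigroup\<close>

lemma Zero_in_PG [simp]: "Zero \<in> PG G"
  by (simp add: PG_def)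

lemma Elem_in_PG: "Elem x y \<in> PG G \<longleftrightarrow> x \<in> fpaths G \<and> y \<in> fpaths G \<and> pdom G x = pdom G y"
  unfolding PG_def by blast

lemma Elem_pext_in_PG:
  "Elem x y \<in> PG G \<Longrightarrow> (pdom G x, p) \<in> fpaths G \<Longrightarrow> Elem (pext x p) (pext y p) \<in> PG G"
  by (auto simp: Elem_in_PG pext_in_fpaths pdom_pext)

text \<open>The range of the factor \<open>z\<close> is forced to be \<open>pdom G y\<close>, so
  \<open>z\<close> reduces to a bare edge list \<open>p\<close>, determined by \<open>u\<close> and
  \<open>y\<close>. This is what evaluates the \<open>THE\<close> in \<open>gmult\<close>.\<close>

lemma pfactor_iff:
  assumes "u \<in> fpaths G"
  shows "pfactor G u y z \<longleftrightarrow> (\<exists>p. z = (pdom G y, p) \<and> u = pext y p)"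
  using assms pext_in_fpaths[of y "snd z"]
  by (cases z) (auto simp: pfactor_def prange_def pconc_def pext_def)

lemma gmult_pext_left:
  assumes "pext y p \<in> fpaths G"
  shows "gmult G (Elem x y) (Elem (pext y p) v) = Elem (pext x p) v"
proof -
  have "pfactor G (pext y p) y = (\<lambda>z. z = (pdom G y, p))"
    using pfactor_iff[OF assms] by (intro ext) auto
  then show ?thesis by (simp add: pconc_def pext_def[of x p])
qed

lemma gmult_pext_right:
  assumes "pext u p \<in> fpaths G"
  shows "gmult G (Elem x (pext u p)) (Elem u v) = Elem x (pext v p)"
proof (cases "p = []")
  \<comment> \<open>For empty \<open>p\<close> both factorizations exist and \<open>gmult\<close>
    takes its first branch.\<close>
  case True
  then show ?thesis using gmult_pext_left[of u "[]"] assms by simp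
next
  case False
  have u: "u \<in> fpaths G" using assms pext_in_fpaths by blast
  have "u \<noteq> pext (pext u p) q" for q
    using False by auto
  then have "\<nexists>z. pfactor G u (pext u p) z"
    using pfactor_iff[OF u] by blast
  moreover have "pfactor G (pext u p) u = (\<lambda>z. z = (pdom G u, p))"
    using pfactor_iff[OF assms] by (intro ext) auto
  ultimately show ?thesis by (simp add: pconc_def pext_def[of v p])
qed

lemma gmult_eq_Zero:
  assumes "y \<in> fpaths G" "u \<in> fpaths G" "\<And>p. u \<noteq> pext y p" "\<And>p. y \<noteq> pext u p"
  shows "gmult G (Elem x y) (Elem u v) = Zero"
  using assms by (simp add: pfactor_iff)

lemma gmult_Zero [simp]: "gmult G Zero s = Zero" "gmult G s Zero = Zero"
  by (cases s; simp)+

declare gmult.simps [simp del]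

lemma gmult_in_PG:
  assumes "s \<in> PG G" "t \<in> PG G"
  shows "gmult G s t \<in> PG G"
proof (cases "s = Zero \<or> t = Zero")
  case False
  then obtain x y u v where s: "s = Elem x y" and t: "t = Elem u v" by (meson gis.exhaust)
  note st = assms[unfolded s t Elem_in_PG]
  consider p where "u = pext y p" | p where "y = pext u p" | "\<And>p. u \<noteq> pext y p" "\<And>p. y \<noteq> pext u p"
    by blast
  then show ?thesis
  proof cases
    case 1
    then show ?thesis using st s t gmult_pext_left[of y p x v]
      by (auto simp: Elem_in_PG pext_in_fpaths pdom_pext)
  next
    case 2
    then show ?thesis using st s t gmult_pext_right[of u p x v]
      by (auto simp: Elem_in_PG pext_in_fpaths pdom_pext)
  next
    case 3
    then show ?thesis using st s t gmult_eq_Zero[of y u x v] by simp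
  qed
qed auto

lemma ginv_in_PG: "s \<in> PG G \<Longrightarrow> ginv s \<in> PG G"
  by (cases s) (auto simp: Elem_in_PG)

text \<open>If one of \<open>x\<close>, \<open>y\<close> properly extended the other, squaring would
  lengthen a component; if neither extends the other, the square is \<open>Zero\<close>.\<close>

lemma gidem_iff: "gidem G e \<longleftrightarrow> e = Zero \<or> (\<exists>x\<in>fpaths G. e = Elem x x)"
proof (cases e)
  case (Elem x y)
  have "x = y" if e: "e \<in> PG G" "gmult G e e = e"
  proof -
    note xy = e(1)[unfolded Elem Elem_in_PG]
    consider p where "x = pext y p" | p where "y = pext x p" | "\<And>p. x \<noteq> pext y p" "\<And>p. y \<noteq> pext x p"
      by blast
    then show ?thesis
    proof cases
      case 1
      then show ?thesis using xy e(2) Elem gmult_pext_left[of y p x y] by auto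
    next
      case 2
      then show ?thesis using xy e(2) Elem gmult_pext_right[of x p x y] by auto
    next
      case 3
      then show ?thesis using xy e(2) Elem gmult_eq_Zero[of y x x y] by simp
    qed
  qed
  moreover have "gmult G (Elem x x) (Elem x x) = Elem x x" if "x \<in> fpaths G"
    using gmult_pext_left[of x "[]" x x] that by simp
  ultimately show ?thesis using Elem by (auto simp: gidem_def Elem_in_PG)
qed (simp add: gidem_def)

lemma gle_Zero_right [simp]: "gle G s Zero \<longleftrightarrow> s = Zero"
  using gidem_iff by (auto simp: gle_def)

lemma gle_Zero_left [simp]: "gle G Zero s \<longleftrightarrow> s \<in> PG G"
  using gidem_iff by (auto simp: gle_def intro!: exI[of _ Zero])

lemma gle_in_PG: "gle G s t \<Longrightarrow> s \<in> PG G" "gle G s t \<Longrightarrow> t \<in> PG G"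
  by (auto simp: gle_def)

text \<open>Multiplying by an idempotent \<open>Elem u u\<close> changes nothing if \<open>u\<close>
  is a prefix of \<open>y\<close>, appends \<open>p\<close> to both components if
  \<open>u = pext y p\<close>, and gives \<open>Zero\<close> otherwise.\<close>

lemma gle_Elem:
  "gle G s (Elem x y) \<longleftrightarrow> Elem x y \<in> PG G \<and>
     (s = Zero \<or> (\<exists>p. (pdom G x, p) \<in> fpaths G \<and> s = Elem (pext x p) (pext y p)))"
  (is "_ \<longleftrightarrow> ?R")
proof
  assume "gle G s (Elem x y)"
  then obtain e where e: "gidem G e" "s = gmult G (Elem x y) e" and xy: "Elem x y \<in> PG G"
    by (auto simp: gle_def)
  show ?R
  proof (cases "e = Zero")
    case False
    then obtain u where u: "e = Elem u u" "u \<in> fpaths G" using e(1) gidem_iff by blast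
    have y: "y \<in> fpaths G" and d: "pdom G x = pdom G y" using xy Elem_in_PG by auto
    consider p where "u = pext y p" | p where "y = pext u p" | "\<And>p. u \<noteq> pext y p" "\<And>p. y \<noteq> pext u p"
      by blast
    then show ?thesis
    proof cases
      case 1
      then show ?thesis using u e(2) xy d gmult_pext_left[of y p x u] by (auto simp: pext_in_fpaths)
    next
      case 2
      then show ?thesis using u e(2) xy y d pdom_in_verts[OF y] gmult_pext_right[of u p x u]
        by (auto intro!: exI[of _ "[]"])
    next
      case 3
      then show ?thesis using u y e(2) xy gmult_eq_Zero[of y u x u] by simp
    qed
  qed (use e xy in simp)
next
  assume R: ?R
  then consider "s = Zero" | p where "(pdom G x, p) \<in> fpaths G" "s = Elem (pext x p) (pext y p)"
    by blast
  then show "gle G s (Elem x y)"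
  proof cases
    case 2
    then have "pext y p \<in> fpaths G" using R by (auto simp: Elem_in_PG pext_in_fpaths)
    then have "gidem G (Elem (pext y p) (pext y p))"
      "s = gmult G (Elem x y) (Elem (pext y p) (pext y p))"
      using 2 gidem_iff gmult_pext_left by auto
    moreover have "s \<in> PG G" using 2 R Elem_pext_in_PG by blast
    ultimately show ?thesis using R unfolding gle_def by blast
  qed (use R in simp)
qed

lemma gle_refl: "s \<in> PG G \<Longrightarrow> gle G s s"
  by (cases s) (auto simp: gle_Elem Elem_in_PG pdom_in_verts intro!: exI[of _ "[]"])

lemma gle_trans:
  assumes "gle G r s" "gle G s t"
  shows "gle G r t"
proof (cases "r = Zero")
  case True
  then show ?thesis using assms gle_in_PG(2) by auto
next
  case False
  then obtain u v x y where "s = Elem u v" "t = Elem x y"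
    using assms by (cases s; cases t) auto
  with False assms obtain p q where
    "(pdom G x, p) \<in> fpaths G" "u = pext x p" "v = pext y p" "Elem x y \<in> PG G"
    "(pdom G u, q) \<in> fpaths G" "r = Elem (pext u q) (pext v q)"
    by (auto simp: gle_Elem)
  then have "(pdom G x, p @ q) \<in> fpaths G \<and> r = Elem (pext x (p @ q)) (pext y (p @ q))"
    by (simp add: append_in_fpaths pdom_pext)
  then show ?thesis using \<open>Elem x y \<in> PG G\<close> \<open>t = Elem x y\<close> gle_Elem by blast
qed

lemma gle_antisym:
  assumes "gle G s t" "gle G t s"
  shows "s = t"
proof (cases "s = Zero \<or> t = Zero")
  case True
  then show ?thesis using assms by auto
next
  case False
  then obtain x y u v where st: "s = Elem x y" "t = Elem u v" by (meson gis.exhaust)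
  with assms obtain p q where
    pq: "x = pext u p" "y = pext v p" "u = pext x q" by (auto simp: gle_Elem)
  then have "p = []" by (metis pext_pext pext_eq_self_iff(2) append_is_Nil_conv)
  with pq st show ?thesis by simp
qed

section \<open>Elements as relations on finite paths\<close>

lemma in_below [simp]: "(a, b) \<in> below G s \<longleftrightarrow> gle G (Elem a b) s"
  by (simp add: below_def)

lemma below_Zero [simp]: "below G Zero = {}"
  by (auto simp: below_def)

lemma below_Elem:
  "below G (Elem x y) =
     (if Elem x y \<in> PG G then {(pext x p, pext y p) | p. (pdom G x, p) \<in> fpaths G} else {})"
  by (auto simp: below_def gle_Elem)

lemma below_ElemE:
  assumes "(a, b) \<in> below G (Elem x y)"
  obtains p where "Elem x y \<in> PG G" "(pdom G x, p) \<in> fpaths G" "a = pext x p" "b = pext y p"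
  using assms by (auto simp: below_Elem split: if_splits)

lemma below_eq_empty_iff: "s \<in> PG G \<Longrightarrow> below G s = {} \<longleftrightarrow> s = Zero"
  using gle_refl[of s] in_below by (cases s) (simp, blast)

text \<open>By reflexivity the pair \<open>(x, y)\<close> itself belongs to
  \<open>below G (Elem x y)\<close>, so an inclusion of relations already compares the
  elements.\<close>

lemma gle_iff_below:
  assumes "s \<in> PG G" "t \<in> PG G"
  shows "gle G s t \<longleftrightarrow> below G s \<subseteq> below G t"
proof
  assume "gle G s t"
  then show "below G s \<subseteq> below G t" using gle_trans by (auto simp: below_def)
next
  assume "below G s \<subseteq> below G t"
  then show "gle G s t"
    using assms gle_refl[of s] in_below by (cases s) (simp, blast)
qed

lemma gidem_iff_below:
  assumes "e \<in> PG G"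
  shows "gidem G e \<longleftrightarrow> below G e \<subseteq> Id"
proof (cases e)
  case (Elem x y)
  have "x = y" if "below G e \<subseteq> Id"
    using that Elem assms gle_refl[of e] in_below by blast
  moreover have "below G (Elem x x) \<subseteq> Id"
    by (rule subrelI, erule below_ElemE) simp
  ultimately show ?thesis using Elem assms by (auto simp: gidem_iff Elem_in_PG)
qed (simp add: gidem_iff)

lemma below_ginv: "below G (ginv s) = (below G s)\<inverse>"
  by (cases s) (auto simp: below_Elem Elem_in_PG)

text \<open>A composable pair meets in a path that extends both \<open>y\<close> and
  \<open>u\<close>. Such a path exists only if one of the two is a prefix of the other; the longer
  one is then the shortest meeting point and yields the product.\<close>

lemma below_gmult:
  assumes "s \<in> PG G" "t \<in> PG G"
  shows "below G (gmult G s t) = below G s O below G t"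
proof (cases "s = Zero \<or> t = Zero")
  case False
  then obtain x y u v where s: "s = Elem x y" and t: "t = Elem u v" by (meson gis.exhaust)
  note st = assms[unfolded s t]
  have d: "x \<in> fpaths G" "y \<in> fpaths G" "pdom G x = pdom G y"
    "u \<in> fpaths G" "v \<in> fpaths G" "pdom G u = pdom G v"
    using st Elem_in_PG by auto
  have bs: "below G s = {(pext x p, pext y p) | p. (pdom G x, p) \<in> fpaths G}"
    and bt: "below G t = {(pext u p, pext v p) | p. (pdom G u, p) \<in> fpaths G}"
    using st s t by (simp_all add: below_Elem)
  consider p where "u = pext y p" | p where "y = pext u p"
    | "\<And>p. u \<noteq> pext y p" "\<And>p. y \<noteq> pext u p"
    by blast
  then show ?thesis
  proof cases
    case 1
    then have p: "(pdom G x, p) \<in> fpaths G" using d pext_in_fpaths by auto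
    have eq: "gmult G s t = Elem (pext x p) v"
      using gmult_pext_left[of y p x v] 1 d s t by simp
    have dom: "pdom G (pext x p) = pdom G u" using 1 d(3) by (simp add: pdom_pext)
    have "Elem (pext x p) v \<in> PG G" using gmult_in_PG[OF assms] eq by simp
    then have "below G (gmult G s t) = {(pext x (p @ q), pext v q) | q. (pdom G u, q) \<in> fpaths G}"
      using dom eq below_Elem[of "pext x p" v] by simp
    also have "\<dots> = below G s O below G t"
    proof
      have "(pext x (p @ q), pext v q) \<in> below G s O below G t"
        if q: "(pdom G u, q) \<in> fpaths G" for q
      proof -
        have "(pdom G x, p @ q) \<in> fpaths G" using q p 1 d by (simp add: append_in_fpaths pdom_pext)
        then have "(pext x (p @ q), pext y (p @ q)) \<in> below G s" unfolding bs by blast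
        moreover have "(pext u q, pext v q) \<in> below G t" unfolding bt using q by blast
        moreover have "pext u q = pext y (p @ q)" using 1 by simp
        ultimately show ?thesis by (metis relcompI)
      qed
      then show "{(pext x (p @ q), pext v q) | q. (pdom G u, q) \<in> fpaths G} \<subseteq> below G s O below G t"
        by blast
      show "below G s O below G t \<subseteq> {(pext x (p @ q), pext v q) | q. (pdom G u, q) \<in> fpaths G}"
      proof (rule subrelI)
        fix a b assume "(a, b) \<in> below G s O below G t"
        then obtain r q where "a = pext x r" "pext y r = pext u q" "b = pext v q"
          "(pdom G u, q) \<in> fpaths G"
          unfolding bs bt by blast
        then show "(a, b) \<in> {(pext x (p @ q), pext v q) | q. (pdom G u, q) \<in> fpaths G}"
          using 1 by simp
      qed
    qed
    finally show ?thesis .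
  next
    case 2
    then have p: "(pdom G v, p) \<in> fpaths G" using d pext_in_fpaths by auto
    have eq: "gmult G s t = Elem x (pext v p)"
      using gmult_pext_right[of u p x v] 2 d s t by simp
    have "Elem x (pext v p) \<in> PG G" using gmult_in_PG[OF assms] eq by simp
    then have "below G (gmult G s t) = {(pext x q, pext v (p @ q)) | q. (pdom G x, q) \<in> fpaths G}"
      using eq below_Elem[of x "pext v p"] by simp
    also have "\<dots> = below G s O below G t"
    proof
      have "(pext x q, pext v (p @ q)) \<in> below G s O below G t"
        if q: "(pdom G x, q) \<in> fpaths G" for q
      proof -
        have "(pdom G u, p @ q) \<in> fpaths G" using q p 2 d by (simp add: append_in_fpaths pdom_pext)
        then have "(pext u (p @ q), pext v (p @ q)) \<in> below G t" unfolding bt by blast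
        moreover have "(pext x q, pext y q) \<in> below G s" unfolding bs using q by blast
        moreover have "pext y q = pext u (p @ q)" using 2 by simp
        ultimately show ?thesis by (metis relcompI)
      qed
      then show "{(pext x q, pext v (p @ q)) | q. (pdom G x, q) \<in> fpaths G} \<subseteq> below G s O below G t"
        by blast
      show "below G s O below G t \<subseteq> {(pext x q, pext v (p @ q)) | q. (pdom G x, q) \<in> fpaths G}"
      proof (rule subrelI)
        fix a b assume "(a, b) \<in> below G s O below G t"
        then obtain q r where "a = pext x q" "pext y q = pext u r" "b = pext v r"
          "(pdom G x, q) \<in> fpaths G"
          unfolding bs bt by blast
        then show "(a, b) \<in> {(pext x q, pext v (p @ q)) | q. (pdom G x, q) \<in> fpaths G}"
          using 2 by simp
      qed
    qed
    finally show ?thesis .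
  next
    case 3
    have "pext y p \<noteq> pext u q" for p q
      using pext_eq_pextD[of y p u q] 3 by blast
    then have "below G s O below G t = {}" unfolding bs bt by blast
    then show ?thesis using gmult_eq_Zero[of y u x v] 3 d s t by simp
  qed
qed auto

text \<open>In this form compatibility says that the union of the two partial bijections is again
  one.\<close>

lemma compatible_iff_below:
  assumes "s \<in> PG G" "t \<in> PG G"
  shows "compatible G s t \<longleftrightarrow>
    (below G s)\<inverse> O below G t \<subseteq> Id \<and> below G s O (below G t)\<inverse> \<subseteq> Id"
  using assms
  by (simp add: compatible_def gidem_iff_below gmult_in_PG ginv_in_PG below_gmult below_ginv)

lemma orthogonal_iff_below:
  assumes "s \<in> PG G" "t \<in> PG G"
  shows "orthogonal G s t \<longleftrightarrow>
    (below G s)\<inverse> O below G t = {} \<and> below G s O (below G t)\<inverse> = {}"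
  using assms
  by (simp add: orthogonal_def below_eq_empty_iff[symmetric] gmult_in_PG ginv_in_PG
      below_gmult below_ginv)

text \<open>The first coordinate \<open>a\<close> decides which of \<open>x\<close>,
  \<open>u\<close> is a prefix of the other. The appended tails are the same in both coordinates, so
  cancelling them in \<open>b\<close> makes the second components follow with the same remainder
  \<open>r\<close>.\<close>

lemma comparable_if_common_below:
  assumes "(a, b) \<in> below G s" "(a, b) \<in> below G t"
  shows "gle G s t \<or> gle G t s"
proof -
  obtain x y u v where s: "s = Elem x y" and t: "t = Elem u v"
    using assms by (cases s; cases t) auto
  obtain p where p: "Elem x y \<in> PG G" "(pdom G x, p) \<in> fpaths G" "a = pext x p" "b = pext y p"
    using assms(1) s below_ElemE by blast
  obtain q where q: "Elem u v \<in> PG G" "(pdom G u, q) \<in> fpaths G" "a = pext u q" "b = pext v q"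
    using assms(2) t below_ElemE by blast
  from pext_eq_pextD[of x p u q] p(3) q(3)
  consider r where "x = pext u r" "q = r @ p" | r where "u = pext x r" "p = r @ q" by blast
  then show ?thesis
  proof cases
    case 1
    have "y = pext v r" using p(4) q(4) 1 pext_eq_pext_lengthD[of y p "pext v r" p] by simp
    then have "gle G s t" using s t 1 p q by (auto simp: gle_Elem append_in_fpaths)
    then show ?thesis ..
  next
    case 2
    have "v = pext y r" using p(4) q(4) 2 pext_eq_pext_lengthD[of v q "pext y r" q] by simp
    then have "gle G t s" using s t 2 p q by (auto simp: gle_Elem append_in_fpaths)
    then show ?thesis ..
  qed
qed

section \<open>Meets\<close>

lemma gmeet_eqI:
  assumes "gle G m s" "gle G m t" "\<And>z. gle G z s \<Longrightarrow> gle G z t \<Longrightarrow> gle G z m"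
  shows "gmeet G s t = m"
  unfolding gmeet_def using assms gle_antisym by (intro the_equality) blast+

text \<open>A common nonzero lower bound forces comparability, so the meet is the smaller of two
  comparable elements and \<open>Zero\<close> in all other cases.\<close>

lemma gmeet_nonzero_iff:
  assumes "s \<in> PG G" "t \<in> PG G" "s \<noteq> Zero" "t \<noteq> Zero"
  shows "gmeet G s t \<noteq> Zero \<longleftrightarrow> gle G s t \<or> gle G t s"
proof -
  consider "gle G s t" | "gle G t s" | "\<not> gle G s t" "\<not> gle G t s" by blast
  then show ?thesis
  proof cases
    case 1
    then have "gmeet G s t = s" using assms gle_refl by (intro gmeet_eqI)
    then show ?thesis using 1 assms by simp
  next
    case 2
    then have "gmeet G s t = t" using assms gle_refl by (intro gmeet_eqI)
    then show ?thesis using 2 assms by simp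
  next
    case 3
    have "gle G z Zero" if "gle G z s" "gle G z t" for z
      using that 3 comparable_if_common_below in_below by (cases z) (simp, blast)
    then have "gmeet G s t = Zero" using assms by (intro gmeet_eqI) auto
    then show ?thesis using 3 by simp
  qed
qed

section \<open>Orthogonal generators\<close>

lemma down_closure_subset_PG: "down_closure G S \<subseteq> PG G"
  by (auto simp: down_closure_def dest: gle_in_PG)

lemma subset_down_closure: "S \<subseteq> PG G \<Longrightarrow> S \<subseteq> down_closure G S"
  using gle_refl by (auto simp: down_closure_def)

lemma DP_E:
  assumes "X \<in> DP G"
  obtains S where "S \<subseteq> PG G" "finite S" "S \<noteq> {}" "\<And>s t. s \<in> S \<Longrightarrow> t \<in> S \<Longrightarrow> compatible G s t"
    "X = down_closure G S"
  using assms by (auto simp: DP_def)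

lemma DP_subset_PG: "X \<in> DP G \<Longrightarrow> X \<subseteq> PG G"
  by (auto simp: DP_def dest: subsetD[OF down_closure_subset_PG])

lemma DP_down: "X \<in> DP G \<Longrightarrow> s \<in> X \<Longrightarrow> gle G r s \<Longrightarrow> r \<in> X"
  by (erule DP_E) (auto simp: down_closure_def intro: gle_trans)

lemma Zero_in_DP: "X \<in> DP G \<Longrightarrow> Zero \<in> X"
  by (erule DP_E) (auto simp: down_closure_def)

text \<open>An explicit candidate for the \<open>THE\<close> in \<open>orth_gens\<close>: it depends
  on \<open>X\<close> alone, which gives uniqueness of the generators.\<close>

definition maximal_elems :: "('a, 'b) fpath gis set \<Rightarrow> ('a, 'b) fpath gis set" where
  "maximal_elems X = {m \<in> X - {Zero}. \<forall>s\<in>X. gle G m s \<longrightarrow> s = m}"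

lemma ex_maximal_elem:
  assumes "s \<in> X" "s \<noteq> Zero" "s \<in> PG G"
  shows "\<exists>m \<in> maximal_elems X. gle G s m"
proof -
  \<comment> \<open>Going strictly up shortens the first path, so an upper bound of \<open>s\<close>
    in \<open>X\<close> with shortest first path is maximal. The value at \<open>Zero\<close> is a
    dummy, since nothing above \<open>s\<close> is zero.\<close>
  define f where "f t = (case t of Zero \<Rightarrow> 0 | Elem x y \<Rightarrow> plen x)" for t :: "('a, 'b) fpath gis"
  obtain m where m: "m \<in> X" "gle G s m"
    and min: "\<And>t. t \<in> X \<Longrightarrow> gle G s t \<Longrightarrow> f m \<le> f t"
    using ex_has_least_nat[of "\<lambda>t. t \<in> X \<and> gle G s t" s f] assms gle_refl by blast
  have "m \<noteq> Zero" using m assms by auto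
  moreover have "t = m" if t: "t \<in> X" "gle G m t" for t
  proof -
    have "f m \<le> f t" using t m min gle_trans by blast
    moreover have "t \<noteq> Zero" using t \<open>m \<noteq> Zero\<close> by auto
    ultimately show ?thesis using t(2) \<open>m \<noteq> Zero\<close>
      by (cases t) (auto simp: f_def gle_Elem)
  qed
  ultimately show ?thesis using m by (auto simp: maximal_elems_def)
qed

text \<open>Orthogonal nonzero elements are incomparable, because an inclusion of their nonempty
  relations would make the composite in \<open>orthogonal_iff_below\<close> nonempty. A generating
  antichain consists of the maximal elements.\<close>

lemma orth_gens_unique:
  assumes "A \<subseteq> PG G - {Zero}" "pairwise (orthogonal G) A" "X = down_closure G A"
  shows "A = maximal_elems X"
proof -
  have sub: "A \<subseteq> X" using assms subset_down_closure by blast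
  have inc: "a = a'" if "a \<in> A" "a' \<in> A" "gle G a a'" for a a'
  proof (rule ccontr)
    assume "a \<noteq> a'"
    then have "orthogonal G a a'" using assms(2) that by (auto simp: pairwise_def)
    then have "(below G a)\<inverse> O below G a' = {}" using orthogonal_iff_below assms(1) that by blast
    moreover have "below G a \<subseteq> below G a'" using gle_iff_below gle_in_PG that(3) by blast
    moreover have "below G a \<noteq> {}" using below_eq_empty_iff assms(1) that by blast
    ultimately show False by fast
  qed
  show ?thesis
  proof (intro equalityI subsetI)
    fix a assume a: "a \<in> A"
    have "s = a" if s: "s \<in> X" "gle G a s" for s
    proof -
      obtain a' where "a' \<in> A" "gle G s a'" using s(1) assms(3) by (auto simp: down_closure_def)
      then show ?thesis using inc[OF a] gle_trans gle_antisym s(2) by blast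
    qed
    then show "a \<in> maximal_elems X" using a sub assms(1) by (auto simp: maximal_elems_def)
  next
    fix m assume m: "m \<in> maximal_elems X"
    then obtain a where "a \<in> A" "gle G m a"
      using assms(3) by (auto simp: maximal_elems_def down_closure_def)
    then show "m \<in> A" using m sub by (auto simp: maximal_elems_def)
  qed
qed

text \<open>Maximal elements lie in every generating set, so they are finitely many and compatible.
  Compatibility turns a shared coordinate of two relations into a shared pair, and a shared pair
  would make two maximal elements comparable; hence they are orthogonal.\<close>

lemma orth_gens_maximal_elems:
  assumes "X \<in> DP G" "X \<noteq> {Zero}"
  shows "finite (maximal_elems X)" "maximal_elems X \<subseteq> PG G - {Zero}"
    "pairwise (orthogonal G) (maximal_elems X)" "X = down_closure G (maximal_elems X)"
proof -
  obtain S where S: "S \<subseteq> PG G" "finite S" "\<And>s t. s \<in> S \<Longrightarrow> t \<in> S \<Longrightarrow> compatible G s t"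
    "X = down_closure G S" using assms(1) by (rule DP_E) blast
  have SX: "S \<subseteq> X" using subset_down_closure S by blast
  have MS: "maximal_elems X \<subseteq> S"
  proof
    fix m assume m: "m \<in> maximal_elems X"
    then obtain s where "s \<in> S" "gle G m s" using S(4) by (auto simp: maximal_elems_def down_closure_def)
    then show "m \<in> S" using m SX by (auto simp: maximal_elems_def)
  qed
  show "finite (maximal_elems X)" using finite_subset[OF MS S(2)] .
  show M: "maximal_elems X \<subseteq> PG G - {Zero}" using MS S(1) by (auto simp: maximal_elems_def)
  show "pairwise (orthogonal G) (maximal_elems X)"
  proof (rule pairwiseI)
    fix m n assume mn: "m \<in> maximal_elems X" "n \<in> maximal_elems X" "m \<noteq> n"
    have P: "m \<in> PG G" "n \<in> PG G" using mn M by auto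
    have c: "(below G m)\<inverse> O below G n \<subseteq> Id" "below G m O (below G n)\<inverse> \<subseteq> Id"
      using S(3)[of m n] mn MS compatible_iff_below[OF P] by auto
    have no: "below G m \<inter> below G n = {}"
    proof (rule ccontr)
      assume "below G m \<inter> below G n \<noteq> {}"
      then obtain a b where "(a, b) \<in> below G m \<inter> below G n" by (metis equals0I prod.exhaust)
      then have "gle G m n \<or> gle G n m" using comparable_if_common_below by blast
      then show False using mn by (auto simp: maximal_elems_def)
    qed
    show "orthogonal G m n"
      unfolding orthogonal_iff_below[OF P] using c no by blast
  qed
  show "X = down_closure G (maximal_elems X)"
  proof (intro equalityI subsetI)
    fix s assume s: "s \<in> X"
    \<comment> \<open>\<open>Zero\<close> too must lie below a maximal element, and these are
      nonzero; so for \<open>s = Zero\<close> some nonzero \<open>r\<close> of \<open>X\<close>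
      stands in for it.\<close>
    obtain r where r: "r \<in> X" "r \<noteq> Zero" "s \<noteq> Zero \<Longrightarrow> r = s"
      using assms s Zero_in_DP by blast
    have "r \<in> PG G" using r assms DP_subset_PG by blast
    then obtain m where "m \<in> maximal_elems X" "gle G r m" using ex_maximal_elem r by blast
    moreover from this have "gle G s m" using r gle_in_PG by (cases "s = Zero") auto
    ultimately show "s \<in> down_closure G (maximal_elems X)" by (auto simp: down_closure_def)
  next
    fix s assume "s \<in> down_closure G (maximal_elems X)"
    then show "s \<in> X" using DP_down[OF assms(1)] by (auto simp: down_closure_def maximal_elems_def)
  qed
qed

lemma orth_gens_props:
  assumes "X \<in> DP G" "X \<noteq> {Zero}"
  shows "finite (orth_gens G X)" "orth_gens G X \<subseteq> PG G - {Zero}"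
    "X = down_closure G (orth_gens G X)"
proof -
  have "orth_gens G X = maximal_elems X"
    unfolding orth_gens_def
  proof (rule the_equality)
    show "finite (maximal_elems X) \<and> maximal_elems X \<subseteq> PG G - {Zero} \<and>
      pairwise (orthogonal G) (maximal_elems X) \<and> X = down_closure G (maximal_elems X)"
      using orth_gens_maximal_elems[OF assms] by (intro conjI)
  qed (elim conjE, rule orth_gens_unique)
  then show "finite (orth_gens G X)" "orth_gens G X \<subseteq> PG G - {Zero}"
    "X = down_closure G (orth_gens G X)"
    using orth_gens_maximal_elems[OF assms] by simp_all
qed

lemma DP_mult_in_DP:
  assumes "X \<in> DP G" "Y \<in> DP G"
  shows "DP_mult G X Y \<in> DP G"
proof -
  obtain S where S: "S \<subseteq> PG G" "finite S" "S \<noteq> {}"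
    "\<And>s t. s \<in> S \<Longrightarrow> t \<in> S \<Longrightarrow> compatible G s t" "X = down_closure G S"
    using assms(1) by (rule DP_E) blast
  obtain T where T: "T \<subseteq> PG G" "finite T" "T \<noteq> {}"
    "\<And>s t. s \<in> T \<Longrightarrow> t \<in> T \<Longrightarrow> compatible G s t" "Y = down_closure G T"
    using assms(2) by (rule DP_E) blast
  define R where "R = (\<lambda>(s, t). gmult G s t) ` (S \<times> T)"
  have R: "R \<subseteq> PG G" "finite R" "R \<noteq> {}"
    using S(1-3) T(1-3) by (auto simp: R_def intro!: gmult_in_PG)
  have "compatible G q r" if qr: "q \<in> R" "r \<in> R" for q r
  proof -
    obtain s t s' t' where st: "s \<in> S" "t \<in> T" "q = gmult G s t"
      "s' \<in> S" "t' \<in> T" "r = gmult G s' t'"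
      using qr by (auto simp: R_def)
    have P: "s \<in> PG G" "t \<in> PG G" "s' \<in> PG G" "t' \<in> PG G" using st S T by auto
    have c: "(below G s)\<inverse> O below G s' \<subseteq> Id" "below G s O (below G s')\<inverse> \<subseteq> Id"
      "(below G t)\<inverse> O below G t' \<subseteq> Id" "below G t O (below G t')\<inverse> \<subseteq> Id"
      using S(4)[OF st(1,4)] T(4)[OF st(2,5)] P compatible_iff_below by blast+
    have b: "below G q = below G s O below G t" "below G r = below G s' O below G t'"
      using st P below_gmult by simp_all
    have "(below G q)\<inverse> O below G r \<subseteq> Id"
    proof (rule subrelI)
      fix a c assume "(a, c) \<in> (below G q)\<inverse> O below G r"
      then obtain i j k where "(i, j) \<in> below G s" "(j, a) \<in> below G t"
        "(i, k) \<in> below G s'" "(k, c) \<in> below G t'"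
        unfolding b by blast
      then show "(a, c) \<in> Id" using c(1,3) by blast
    qed
    moreover have "below G q O (below G r)\<inverse> \<subseteq> Id"
    proof (rule subrelI)
      fix a c assume "(a, c) \<in> below G q O (below G r)\<inverse>"
      then obtain i j k where "(a, j) \<in> below G s" "(j, i) \<in> below G t"
        "(c, k) \<in> below G s'" "(k, i) \<in> below G t'"
        unfolding b by blast
      then show "(a, c) \<in> Id" using c(2,4) by blast
    qed
    ultimately show ?thesis using compatible_iff_below R qr by blast
  qed
  moreover have "DP_mult G X Y = down_closure G R"
  proof (intro equalityI subsetI)
    fix r assume "r \<in> DP_mult G X Y"
    then obtain s t s' t' where st: "r = gmult G s t" "gle G s s'" "s' \<in> S" "gle G t t'" "t' \<in> T"
      using S T by (auto simp: DP_mult_def down_closure_def)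
    then have P: "s \<in> PG G" "t \<in> PG G" "s' \<in> PG G" "t' \<in> PG G" using gle_in_PG by blast+
    have "below G s O below G t \<subseteq> below G s' O below G t'"
      using st gle_iff_below P by (intro relcomp_mono) blast+
    then have "gle G r (gmult G s' t')"
      using st P by (simp add: gle_iff_below below_gmult gmult_in_PG)
    then show "r \<in> down_closure G R" using st by (auto simp: down_closure_def R_def)
  next
    fix r assume "r \<in> down_closure G R"
    then obtain s t where st: "s \<in> S" "t \<in> T" "gle G r (gmult G s t)"
      by (auto simp: down_closure_def R_def)
    show "r \<in> DP_mult G X Y"
    proof (cases r)
      case Zero
      then show ?thesis using assms Zero_in_DP gmult_Zero(1) by (force simp: DP_mult_def)
    next
      case (Elem a b)
      then have "(a, b) \<in> below G s O below G t"
        using st S T below_gmult[of s t] by (auto simp: below_def)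
      \<comment> \<open>The middle path \<open>c\<close> of the composition splits \<open>r\<close>
        exactly into \<open>Elem a c\<close> and \<open>Elem c b\<close>, both in the given
        ideals.\<close>
      then obtain c where c: "gle G (Elem a c) s" "gle G (Elem c b) t" by (auto simp: below_def)
      then have "c \<in> fpaths G" using gle_in_PG Elem_in_PG by blast
      then have "gmult G (Elem a c) (Elem c b) = r"
        using gmult_pext_left[of c "[]" a b] Elem by simp
      moreover have "Elem a c \<in> X" "Elem c b \<in> Y"
        using c st S T by (auto simp: down_closure_def)
      ultimately show ?thesis by (auto simp: DP_mult_def)
    qed
  qed
  ultimately show ?thesis using R unfolding DP_def by blast
qed

section \<open>Infinite paths\<close>

lemma build_in_ipaths:
  "e ## w \<in> ipaths G \<longleftrightarrow> e \<in> arcs G \<and> w \<in> ipaths G \<and> tail G e = head G (w 0)"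
proof -
  have all_Suc: "(\<forall>i. P i) \<longleftrightarrow> P 0 \<and> (\<forall>i. P (Suc i))" for P :: "nat \<Rightarrow> bool"
    by (metis not0_implies_Suc)
  have "range (e ## w) \<subseteq> arcs G \<longleftrightarrow> e \<in> arcs G \<and> range w \<subseteq> arcs G"
    using all_Suc[of "\<lambda>i. (e ## w) i \<in> arcs G"] by auto
  moreover have "(\<forall>i. tail G ((e ## w) i) = head G ((e ## w) (Suc i))) \<longleftrightarrow>
      tail G e = head G (w 0) \<and> (\<forall>i. tail G (w i) = head G (w (Suc i)))"
    by (subst all_Suc) simp
  ultimately show ?thesis by (auto simp: ipaths_def)
qed

lemma conc_in_ipaths:
  assumes "v \<in> verts G"
  shows "p \<frown> t \<in> ipaths G \<and> head G ((p \<frown> t) 0) = v \<longleftrightarrow>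
    (v, p) \<in> fpaths G \<and> t \<in> ipaths G \<and> pdom G (v, p) = head G (t 0)"
  using assms
proof (induction p arbitrary: v)
  case (Cons e p)
  have "e \<in> arcs G \<Longrightarrow> tail G e \<in> verts G" by simp
  from Cons.IH[OF this] show ?case
    by (auto simp: build_in_ipaths Cons_in_fpaths)
qed auto

lemma ifactor_conc:
  assumes "x \<in> fpaths G" "t \<in> ipaths G" "pdom G x = head G (t 0)"
  shows "ifactor G (snd x \<frown> t) x t"
  using assms conc_in_ipaths[of "fst x" "snd x" t] by (auto simp: ifactor_def fpaths_def)

lemma ifactor_pext: "ifactor G w (pext x p) t \<longleftrightarrow> ifactor G w x (p \<frown> t)"
proof
  assume "ifactor G w (pext x p) t"
  then show "ifactor G w x (p \<frown> t)"
    unfolding ifactor_iff pext_in_fpaths by (metis conc_conc pext_def fst_conv snd_conv)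
next
  assume a: "ifactor G w x (p \<frown> t)"
  then have "x \<in> fpaths G" "p \<frown> t \<in> ipaths G \<and> head G ((p \<frown> t) 0) = pdom G x"
    by (auto simp: ifactor_def)
  then have "pext x p \<in> fpaths G"
    using conc_in_ipaths[OF pdom_in_verts] pext_in_fpaths by blast
  with a show "ifactor G w (pext x p) t"
    unfolding ifactor_iff by (metis conc_conc pext_def fst_conv snd_conv)
qed

lemma ifactor_unique:
  assumes "ifactor G w x t" "ifactor G w u t'" "plen x = plen u"
  shows "x = u" "t = t'"
  using ifactor_split[OF assms(1,2)] assms(3) by (auto simp: plen_def prod_eq_iff)

lemma ipath_if_fpaths:
  assumes "\<And>n. (v, map t [0..<n]) \<in> fpaths G"
  shows "t \<in> ipaths G" "head G (t 0) = v"
proof -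
  have "t i \<in> arcs G \<and> tail G (t i) = head G (t (Suc i))" for i
    using assms[of "Suc (Suc i)"] by (auto simp: fpaths_def successively_append_iff)
  then show "t \<in> ipaths G" by (auto simp: ipaths_def)
  show "head G (t 0) = v" using assms[of "Suc 0"] by (auto simp: fpaths_def)
qed

section \<open>Cylinders\<close>

lemma Zset_iff:
  "(w, k, w') \<in> Zset G x y \<longleftrightarrow>
     (\<exists>t. ifactor G w x t \<and> ifactor G w' y t \<and> k = int (plen y) - int (plen x))"
  unfolding Zset_def groupoid_def by blast

lemma Zset_subset_groupoid: "Zset G x y \<subseteq> groupoid G"
  by (auto simp: Zset_def)

lemma Zset_conc:
  assumes "Elem x y \<in> PG G" "t \<in> ipaths G" "pdom G x = head G (t 0)"
  shows "(snd x \<frown> t, int (plen y) - int (plen x), snd y \<frown> t) \<in> Zset G x y"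
  unfolding Zset_iff
proof (intro exI conjI refl)
  show "ifactor G (snd x \<frown> t) x t" "ifactor G (snd y \<frown> t) y t"
    using assms by (auto simp: Elem_in_PG intro!: ifactor_conc)
qed

lemma Zset_in_Zbasis: "Elem x y \<in> PG G \<Longrightarrow> Zset G x y \<in> Zbasis G"
  unfolding Zbasis_def Elem_in_PG by blast

lemma Zset_pext_subset: "Zset G (pext x p) (pext y p) \<subseteq> Zset G x y"
proof
  fix g assume "g \<in> Zset G (pext x p) (pext y p)"
  then show "g \<in> Zset G x y"
    by (cases g) (auto simp: Zset_iff ifactor_pext)
qed

lemma Zset_mono: "gle G (Elem a b) (Elem x y) \<Longrightarrow> Zset G a b \<subseteq> Zset G x y"
  unfolding gle_Elem using Zset_pext_subset by blast

text \<open>The next \<open>n\<close> edges of the common infinite tail of \<open>g\<close> are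
  moved into both labels. Choosing \<open>n\<close> is the means of giving labels a prescribed
  length.\<close>

lemma Zset_refine:
  assumes "g \<in> Zset G x y" "Elem x y \<in> PG G"
  obtains p where "length p = n" "gle G (Elem (pext x p) (pext y p)) (Elem x y)"
    "g \<in> Zset G (pext x p) (pext y p)"
proof -
  obtain w k w' where g: "g = (w, k, w')" by (cases g)
  obtain t where t: "ifactor G w x t" "ifactor G w' y t" "k = int (plen y) - int (plen x)"
    using assms(1) g Zset_iff by blast
  define p where "p = prefix n t"
  have "t = p \<frown> suffix n t" by (simp add: p_def)
  then have i: "ifactor G w (pext x p) (suffix n t)" "ifactor G w' (pext y p) (suffix n t)"
    using t ifactor_pext by metis+
  then have "g \<in> Zset G (pext x p) (pext y p)" using g t(3) by (auto simp: Zset_iff)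
  moreover have "(pdom G x, p) \<in> fpaths G" using i(1) pext_in_fpaths by (auto simp: ifactor_def)
  then have "gle G (Elem (pext x p) (pext y p)) (Elem x y)" using assms(2) by (auto simp: gle_Elem)
  moreover have "length p = n" by (simp add: p_def)
  ultimately show ?thesis using that by blast
qed

text \<open>The degree \<open>k\<close> fixes the difference of the label lengths, so the second
  labels have equal length too, and a prefix of an infinite path is determined by its
  length.\<close>

lemma Zset_eq_plen:
  assumes "g \<in> Zset G x y" "g \<in> Zset G u v" "plen x = plen u"
  shows "x = u" "y = v"
proof -
  obtain w k w' where g: "g = (w, k, w')" by (cases g)
  obtain t t' where t: "ifactor G w x t" "ifactor G w' y t" "k = int (plen y) - int (plen x)"
    "ifactor G w u t'" "ifactor G w' v t'" "k = int (plen v) - int (plen u)"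
    using assms(1,2) g Zset_iff by metis
  then have "plen y = plen v" using assms(3) by linarith
  then show "x = u" "y = v" using ifactor_unique t assms(3) by metis+
qed

lemma comparable_if_Zset_meet:
  assumes "g \<in> Zset G x y" "g \<in> Zset G u v" "Elem x y \<in> PG G" "Elem u v \<in> PG G"
  shows "gle G (Elem x y) (Elem u v) \<or> gle G (Elem u v) (Elem x y)"
proof -
  \<comment> \<open>Each first label is lengthened by the length of the other one, so that both
    reach \<open>plen x + plen u\<close>.\<close>
  obtain p where p: "length p = plen u" "gle G (Elem (pext x p) (pext y p)) (Elem x y)"
    "g \<in> Zset G (pext x p) (pext y p)" using Zset_refine[OF assms(1,3)] .
  obtain q where q: "length q = plen x" "gle G (Elem (pext u q) (pext v q)) (Elem u v)"
    "g \<in> Zset G (pext u q) (pext v q)" using Zset_refine[OF assms(2,4)] .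
  have "pext x p = pext u q" "pext y p = pext v q"
    using Zset_eq_plen[OF p(3) q(3)] p(1) q(1) by simp_all
  then show ?thesis using comparable_if_common_below p(2) q(2) in_below by metis
qed

section \<open>The bisection of an element of the semigroup of compatible order ideals\<close>

definition zunion :: "('a, 'b) fpath gis set \<Rightarrow> 'b gpd_elem set" where
  "zunion X = \<Union>{Zset G a b | a b. Elem a b \<in> X}"

lemma zunionI: "g \<in> Zset G a b \<Longrightarrow> Elem a b \<in> X \<Longrightarrow> g \<in> zunion X"
  unfolding zunion_def by blast

lemma zunionE:
  assumes "g \<in> zunion X"
  obtains a b where "Elem a b \<in> X" "g \<in> Zset G a b"
  using assms unfolding zunion_def by blast

lemma zunion_down_closure:
  assumes "S \<subseteq> PG G"
  shows "zunion (down_closure G S) = zunion S"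
proof (intro equalityI subsetI)
  fix g assume "g \<in> zunion (down_closure G S)"
  then obtain a b s where ab: "gle G (Elem a b) s" "s \<in> S" "g \<in> Zset G a b"
    by (elim zunionE) (auto simp: down_closure_def)
  then obtain x y where "s = Elem x y" by (cases s) auto
  then show "g \<in> zunion S" using ab Zset_mono zunionI by blast
next
  fix g assume "g \<in> zunion S"
  then show "g \<in> zunion (down_closure G S)"
    using subset_down_closure[OF assms] by (blast elim: zunionE intro: zunionI)
qed

lemma arrow_imp_zunion_subset:
  assumes A: "A \<subseteq> PG G" and B: "B \<subseteq> PG G - {Zero}" "finite B" and "arrow G A B"
  shows "zunion A \<subseteq> zunion B"
proof
  fix g assume "g \<in> zunion A"
  then obtain x y where xy: "Elem x y \<in> A" "g \<in> Zset G x y" by (rule zunionE)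
  \<comment> \<open>With a first label longer than every first label in \<open>B\<close>, the
    refined element cannot have an element of \<open>B\<close> below it, so the nonzero meet places
    it below one. The value 0 at \<open>Zero\<close> is a dummy, as \<open>B\<close> omits
    \<open>Zero\<close>.\<close>
  obtain n where n: "\<And>u v. Elem u v \<in> B \<Longrightarrow> plen u < n"
  proof -
    have "finite ((\<lambda>s. case s of Zero \<Rightarrow> 0 | Elem u v \<Rightarrow> plen u) ` B)" using B by simp
    then obtain n where "\<forall>s\<in>B. (case s of Zero \<Rightarrow> 0 | Elem u v \<Rightarrow> plen u) < n"
      using finite_nat_set_iff_bounded by auto
    then show ?thesis using that by fastforce
  qed
  have xyP: "Elem x y \<in> PG G" using xy A by blast
  obtain p where p: "length p = n" "gle G (Elem (pext x p) (pext y p)) (Elem x y)"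
    "g \<in> Zset G (pext x p) (pext y p)" using Zset_refine[OF xy(2) xyP] .
  obtain b where b: "b \<in> B" "gmeet G (Elem (pext x p) (pext y p)) b \<noteq> Zero"
    using assms(4) xy(1) p(2) unfolding arrow_def by blast
  obtain u v where uv: "b = Elem u v" using b B by (cases b) auto
  have "gle G (Elem (pext x p) (pext y p)) b \<or> gle G b (Elem (pext x p) (pext y p))"
    using gmeet_nonzero_iff[of "Elem (pext x p) (pext y p)" b] b B gle_in_PG(1)[OF p(2)] by auto
  moreover have "\<not> gle G b (Elem (pext x p) (pext y p))"
    using n[of u v] b(1) uv p(1) by (auto simp: gle_Elem)
  ultimately show "g \<in> zunion B" using p(3) b(1) uv Zset_mono zunionI by blast
qed

lemma Zset_det:
  assumes "(w, k, w') \<in> Zset G a c" "(u, l, w') \<in> Zset G a c"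
  shows "w = u \<and> k = l"
proof -
  obtain t t' where t: "ifactor G w a t" "ifactor G w' c t" "k = int (plen c) - int (plen a)"
    "ifactor G u a t'" "ifactor G w' c t'" "l = int (plen c) - int (plen a)"
    using assms Zset_iff by metis
  then have "t = t'" using ifactor_unique by blast
  then show ?thesis using t by (auto simp: ifactor_def)
qed

lemma Zset_swap: "(w, k, w') \<in> Zset G x y \<longleftrightarrow> (w', - k, w) \<in> Zset G y x"
  by (auto simp: Zset_iff)

text \<open>The groupoid counterpart of relation composition: both middle labels are prefixes of
  \<open>w'\<close>, so extending them to the common length \<open>plen y + plen u\<close> makes
  them equal.\<close>

lemma Zset_meet_in_middle:
  assumes "(w, k, w') \<in> Zset G x y" "(w', l, w'') \<in> Zset G u v"
    "Elem x y \<in> PG G" "Elem u v \<in> PG G"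
  obtains a b c where "gle G (Elem a c) (Elem x y)" "(w, k, w') \<in> Zset G a c"
    "gle G (Elem c b) (Elem u v)" "(w', l, w'') \<in> Zset G c b"
proof -
  obtain p where p: "length p = plen u" "gle G (Elem (pext x p) (pext y p)) (Elem x y)"
    "(w, k, w') \<in> Zset G (pext x p) (pext y p)" using Zset_refine[OF assms(1,3)] .
  obtain q where q: "length q = plen y" "gle G (Elem (pext u q) (pext v q)) (Elem u v)"
    "(w', l, w'') \<in> Zset G (pext u q) (pext v q)" using Zset_refine[OF assms(2,4)] .
  have "pext y p = pext u q"
    using p(1,3) q(1,3) ifactor_unique(1)[of w' "pext y p" _ "pext u q"] by (auto simp: Zset_iff)
  then show ?thesis using that p q by metis
qed

lemma zunion_DP_mult:
  assumes "X \<in> DP G" "Y \<in> DP G"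
  shows "zunion (DP_mult G X Y) = gpd_set_mult (zunion X) (zunion Y)"
proof (intro equalityI subsetI)
  fix g assume "g \<in> zunion (DP_mult G X Y)"
  then obtain a b where "Elem a b \<in> DP_mult G X Y" and gab: "g \<in> Zset G a b" by (rule zunionE)
  then obtain s t where st: "s \<in> X" "t \<in> Y" "Elem a b = gmult G s t"
    by (auto simp: DP_mult_def)
  have P: "s \<in> PG G" "t \<in> PG G" using st assms DP_subset_PG by auto
  have "(a, b) \<in> below G s O below G t"
    using gle_refl[OF gmult_in_PG[OF P]] st(3) below_gmult[OF P] in_below by metis
  then obtain c where c: "gle G (Elem a c) s" "gle G (Elem c b) t" by (auto simp: below_def)
  have cXY: "Elem a c \<in> X" "Elem c b \<in> Y" using c st assms DP_down by blast+
  obtain w k w' where g: "g = (w, k, w')" by (cases g)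
  obtain \<tau> where \<tau>: "ifactor G w a \<tau>" "ifactor G w' b \<tau>" "k = int (plen b) - int (plen a)"
    using gab g Zset_iff by blast
  \<comment> \<open>The intermediate infinite path of the factorization is \<open>c\<close> followed
    by the tail that \<open>w\<close> and \<open>w'\<close> share.\<close>
  have "ifactor G (snd c \<frown> \<tau>) c \<tau>"
  proof (rule ifactor_conc)
    have "Elem a c \<in> PG G" using c gle_in_PG by blast
    then show "c \<in> fpaths G" "pdom G c = head G (\<tau> 0)" using \<tau>(1) by (auto simp: Elem_in_PG ifactor_def)
    show "\<tau> \<in> ipaths G" using \<tau>(1) by (simp add: ifactor_def)
  qed
  then have "(w, int (plen c) - int (plen a), snd c \<frown> \<tau>) \<in> zunion X"
    "(snd c \<frown> \<tau>, int (plen b) - int (plen c), w') \<in> zunion Y"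
    using \<tau> cXY by (auto simp: Zset_iff intro!: zunionI)
  moreover have "k = (int (plen c) - int (plen a)) + (int (plen b) - int (plen c))"
    using \<tau>(3) by simp
  ultimately show "g \<in> gpd_set_mult (zunion X) (zunion Y)"
    unfolding gpd_set_mult_def g by blast
next
  fix g assume "g \<in> gpd_set_mult (zunion X) (zunion Y)"
  then obtain w k w' l w'' where g: "g = (w, k + l, w'')" "(w, k, w') \<in> zunion X" "(w', l, w'') \<in> zunion Y"
    by (auto simp: gpd_set_mult_def)
  obtain x y where xy: "Elem x y \<in> X" "(w, k, w') \<in> Zset G x y" using g(2) by (rule zunionE)
  obtain u v where uv: "Elem u v \<in> Y" "(w', l, w'') \<in> Zset G u v" using g(3) by (rule zunionE)
  have P: "Elem x y \<in> PG G" "Elem u v \<in> PG G" using xy uv assms DP_subset_PG by blast+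
  obtain a b c where abc: "gle G (Elem a c) (Elem x y)" "(w, k, w') \<in> Zset G a c"
    "gle G (Elem c b) (Elem u v)" "(w', l, w'') \<in> Zset G c b"
    using Zset_meet_in_middle[OF xy(2) uv(2) P] .
  obtain t t' where t: "ifactor G w a t" "ifactor G w' c t" "k = int (plen c) - int (plen a)"
    "ifactor G w' c t'" "ifactor G w'' b t'" "l = int (plen b) - int (plen c)"
    using abc(2,4) Zset_iff by metis
  have "t = t'" using ifactor_unique t by blast
  then have "g \<in> Zset G a b" using t g(1) by (auto simp: Zset_iff)
  moreover have "Elem a c \<in> X" "Elem c b \<in> Y" using abc xy uv assms DP_down by blast+
  moreover have "gmult G (Elem a c) (Elem c b) = Elem a b"
    using gmult_pext_left[of c "[]" a b] t(2) by (simp add: ifactor_def)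
  ultimately show "g \<in> zunion (DP_mult G X Y)"
    unfolding DP_mult_def by (intro zunionI[of g a b]) (auto, metis)
qed

text \<open>Reversing one of two triples with equal domain makes them composable. Splitting at a
  common middle label \<open>c\<close> gives \<open>Elem a c\<close> and \<open>Elem b c\<close>
  below two generators, so compatibility yields \<open>a = b\<close>. Both triples then lie in one
  cylinder, where \<open>Zset_det\<close> identifies them. Ranges are treated by reversal.\<close>

lemma bisection_zunion:
  assumes "X \<in> DP G"
  shows "bisection G (zunion X)"
proof -
  obtain S where S: "S \<subseteq> PG G" "\<And>s t. s \<in> S \<Longrightarrow> t \<in> S \<Longrightarrow> compatible G s t" "X = down_closure G S"
    using assms by (rule DP_E) blast
  have X: "zunion X = zunion S" using S zunion_down_closure by simp
  have dom: "w = u \<and> k = l" if gh: "(w, k, w') \<in> zunion S" "(u, l, w') \<in> zunion S" for w k w' u l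
  proof -
    obtain x y where xy: "Elem x y \<in> S" "(w, k, w') \<in> Zset G x y" using gh(1) by (rule zunionE)
    obtain x' y' where xy': "Elem x' y' \<in> S" "(u, l, w') \<in> Zset G x' y'" using gh(2) by (rule zunionE)
    have P: "Elem x y \<in> PG G" "Elem x' y' \<in> PG G" "Elem y' x' \<in> PG G"
      using xy xy' S(1) by (auto simp: Elem_in_PG)
    obtain a b c where abc: "gle G (Elem a c) (Elem x y)" "(w, k, w') \<in> Zset G a c"
      "gle G (Elem c b) (Elem y' x')" "(w', - l, u) \<in> Zset G c b"
      using Zset_meet_in_middle[OF xy(2) _ P(1,3), of "- l" u] xy'(2) Zset_swap by metis
    have "gle G (Elem b c) (Elem x' y')" using abc(3) P by (auto simp: gle_Elem Elem_in_PG)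
    then have "a = b"
      using abc(1) compatible_iff_below[OF P(1,2)] S(2)[OF xy(1) xy'(1)] in_below by blast
    then have "(u, l, w') \<in> Zset G a c" using abc(4) Zset_swap by metis
    then show ?thesis using Zset_det abc(2) by blast
  qed
  have ran: "w = u \<and> k = l" if gh: "(w', k, w) \<in> zunion S" "(w', l, u) \<in> zunion S" for w k w' u l
  proof -
    obtain x y where xy: "Elem x y \<in> S" "(w', k, w) \<in> Zset G x y" using gh(1) by (rule zunionE)
    obtain x' y' where xy': "Elem x' y' \<in> S" "(w', l, u) \<in> Zset G x' y'" using gh(2) by (rule zunionE)
    have P: "Elem x y \<in> PG G" "Elem x' y' \<in> PG G" "Elem y x \<in> PG G"
      using xy xy' S(1) by (auto simp: Elem_in_PG)
    obtain a b c where abc: "gle G (Elem a c) (Elem y x)" "(w, - k, w') \<in> Zset G a c"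
      "gle G (Elem c b) (Elem x' y')" "(w', l, u) \<in> Zset G c b"
      using Zset_meet_in_middle[OF _ xy'(2) P(3,2), of w "- k"] xy(2) Zset_swap by metis
    have "gle G (Elem c a) (Elem x y)" using abc(1) P by (auto simp: gle_Elem Elem_in_PG)
    then have "a = b"
      using abc(3) compatible_iff_below[OF P(1,2)] S(2)[OF xy(1) xy'(1)] in_below by blast
    then have "(u, - l, w') \<in> Zset G a c" using abc(4) Zset_swap by metis
    then show ?thesis using Zset_det abc(2) by fastforce
  qed
  have "inj_on gpd_dom (zunion S)" "inj_on gpd_ran (zunion S)"
    using dom ran by (auto intro!: inj_onI)
  moreover have "zunion S \<subseteq> groupoid G"
    using Zset_subset_groupoid by (blast elim: zunionE)
  ultimately show ?thesis using X by (simp add: bisection_def)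
qed

text \<open>Used to recover compatibility from injectivity. Following the labels by one tail
  \<open>t\<close> gives points of both cylinders with the same domain; once they are identified,
  equal degrees give \<open>a\<close> and \<open>b\<close> equal length as prefixes of one
  path.\<close>

lemma bisection_Zset_cancel:
  assumes "bisection G A" "Elem a c \<in> PG G" "Elem b c \<in> PG G" "Zset G a c \<subseteq> A" "Zset G b c \<subseteq> A"
    and "t \<in> ipaths G" "pdom G a = head G (t 0)"
  shows "a = b"
proof -
  have d: "pdom G b = head G (t 0)" using assms(2,3,7) by (simp add: Elem_in_PG)
  let ?g = "(snd a \<frown> t, int (plen c) - int (plen a), snd c \<frown> t)"
  let ?h = "(snd b \<frown> t, int (plen c) - int (plen b), snd c \<frown> t)"
  have gh: "?g \<in> Zset G a c" "?h \<in> Zset G b c"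
    using Zset_conc[OF assms(2,6,7)] Zset_conc[OF assms(3,6) d] by auto
  have "inj_on gpd_dom A" using assms(1) by (simp add: bisection_def)
  then have "?g = ?h"
  proof (rule inj_onD)
    show "gpd_dom ?g = gpd_dom ?h" by simp
  qed (use gh assms(4,5) in blast)+
  then have "plen a = plen b" "?g \<in> Zset G b c" using gh by auto
  then show ?thesis using Zset_eq_plen gh by blast
qed

lemma bisection_Zset_cancel':
  assumes "bisection G A" "Elem c a \<in> PG G" "Elem c b \<in> PG G" "Zset G c a \<subseteq> A" "Zset G c b \<subseteq> A"
    and "t \<in> ipaths G" "pdom G c = head G (t 0)"
  shows "a = b"
proof -
  let ?g = "(snd c \<frown> t, int (plen a) - int (plen c), snd a \<frown> t)"
  let ?h = "(snd c \<frown> t, int (plen b) - int (plen c), snd b \<frown> t)"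
  have gh: "?g \<in> Zset G c a" "?h \<in> Zset G c b"
    using Zset_conc[OF assms(2,6,7)] Zset_conc[OF assms(3,6,7)] by auto
  have "inj_on gpd_ran A" using assms(1) by (simp add: bisection_def)
  then have "?g = ?h"
  proof (rule inj_onD)
    show "gpd_ran ?g = gpd_ran ?h" by simp
  qed (use gh assms(4,5) in blast)+
  then have "?g \<in> Zset G c b" using gh by auto
  then show ?thesis using Zset_eq_plen gh by blast
qed

end

section \<open>Row-finite graphs without sources\<close>

locale row_finite_digraph = wf_digraph +
  assumes finite_in_arcs: "v \<in> verts G \<Longrightarrow> finite (in_arcs G v)"
    and in_arcs_nonempty: "v \<in> verts G \<Longrightarrow> in_arcs G v \<noteq> {}"
begin

lemma ex_ipath:
  assumes "v \<in> verts G"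
  obtains t where "t \<in> ipaths G" "head G (t 0) = v"
proof -
  \<comment> \<open>An incoming edge is chosen at every vertex; following these edges from head to
    tail builds the path.\<close>
  define f where "f u = (SOME e. e \<in> in_arcs G u)" for u
  have f: "f u \<in> arcs G" "head G (f u) = u" if "u \<in> verts G" for u
    using in_arcs_nonempty[OF that] some_in_eq[of "in_arcs G u"] by (auto simp: f_def)
  define u where "u n = ((\<lambda>u. tail G (f u)) ^^ n) v" for n
  have u: "u n \<in> verts G" for n
    by (induction n) (auto simp: u_def assms f)
  have "(\<lambda>n. f (u n)) \<in> ipaths G"
    using u f by (auto simp: ipaths_def) (simp add: u_def)
  moreover have "head G (f (u 0)) = v" using f assms by (simp add: u_def)
  ultimately show ?thesis using that by blast
qed

section \<open>Nonemptiness and compactness of cylinders\<close>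

lemma Zset_nonempty:
  assumes "Elem x y \<in> PG G"
  shows "Zset G x y \<noteq> {}"
proof -
  have "pdom G x \<in> verts G" using assms by (simp add: Elem_in_PG pdom_in_verts)
  then obtain t where "t \<in> ipaths G" "head G (t 0) = pdom G x" by (rule ex_ipath)
  then show ?thesis using Zset_conc[OF assms, of t] by auto
qed

lemma Zset_eq_UN_in_arcs:
  assumes "Elem x y \<in> PG G"
  shows "Zset G x y = (\<Union>e\<in>in_arcs G (pdom G x). Zset G (pext x [e]) (pext y [e]))"
proof (intro equalityI subsetI)
  fix g assume "g \<in> Zset G x y"
  then obtain p where p: "length p = Suc 0" "gle G (Elem (pext x p) (pext y p)) (Elem x y)"
    "g \<in> Zset G (pext x p) (pext y p)"
    using Zset_refine[OF _ assms] by blast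
  then obtain e where e: "p = [e]" by (auto simp: length_Suc_conv)
  then have "e \<in> in_arcs G (pdom G x)"
    using p(2) by (auto simp: gle_Elem Cons_in_fpaths)
  then show "g \<in> (\<Union>e\<in>in_arcs G (pdom G x). Zset G (pext x [e]) (pext y [e]))"
    using p(3) e by blast
next
  fix g assume "g \<in> (\<Union>e\<in>in_arcs G (pdom G x). Zset G (pext x [e]) (pext y [e]))"
  then show "g \<in> Zset G x y" using Zset_pext_subset by blast
qed

text \<open>A cylinder without a finite subcover has a one-edge extension without a finite subcover, as
  the in-degrees are finite. Iterating yields an infinite path, hence a point of the cylinder; a
  member of the cover that contains this point contains one of the extensions.\<close>

lemma compactin_Zset:
  assumes xy: "Elem x y \<in> PG G"
  shows "compactin (groupoid_topology G) (Zset G x y)"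
  unfolding compactin_def
proof (intro conjI allI impI)
  show "Zset G x y \<subseteq> topspace (groupoid_topology G)"
    by (simp add: topspace_groupoid_topology Zset_subset_groupoid)
next
  fix \<U> assume U: "Ball \<U> (openin (groupoid_topology G)) \<and> Zset G x y \<subseteq> \<Union>\<U>"
  define fin where "fin p \<longleftrightarrow> (\<exists>\<F>. finite \<F> \<and> \<F> \<subseteq> \<U> \<and> Zset G (pext x p) (pext y p) \<subseteq> \<Union>\<F>)" for p
  have step: "\<exists>e. (pdom G x, p @ [e]) \<in> fpaths G \<and> \<not> fin (p @ [e])"
    if p: "(pdom G x, p) \<in> fpaths G" "\<not> fin p" for p
  proof (rule ccontr)
    assume neg: "\<not> ?thesis"
    have PG: "Elem (pext x p) (pext y p) \<in> PG G" using Elem_pext_in_PG[OF xy p(1)] .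
    let ?I = "in_arcs G (pdom G (pext x p))"
    have v: "pdom G (pext x p) \<in> verts G" using PG by (simp add: Elem_in_PG pdom_in_verts)
    have "(pdom G x, p @ [e]) \<in> fpaths G" if "e \<in> ?I" for e
      using that p(1) by (auto simp: append_in_fpaths Cons_in_fpaths pdom_pext)
    then have "\<forall>e\<in>?I. fin (p @ [e])" using neg by blast
    then have "\<forall>e\<in>?I. \<exists>\<F>. finite \<F> \<and> \<F> \<subseteq> \<U> \<and>
        Zset G (pext (pext x p) [e]) (pext (pext y p) [e]) \<subseteq> \<Union>\<F>"
      by (simp add: fin_def)
    from bchoice[OF this] obtain F where F: "\<forall>e\<in>?I. finite (F e) \<and> F e \<subseteq> \<U> \<and>
        Zset G (pext (pext x p) [e]) (pext (pext y p) [e]) \<subseteq> \<Union>(F e)" ..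
    have "finite (\<Union>(F ` ?I))" using F finite_in_arcs[OF v] by blast
    moreover have "\<Union>(F ` ?I) \<subseteq> \<U>" using F by blast
    moreover have "Zset G (pext x p) (pext y p) \<subseteq> \<Union>(\<Union>(F ` ?I))"
      unfolding Zset_eq_UN_in_arcs[OF PG]
    proof (rule UN_least)
      fix e assume e: "e \<in> ?I"
      then have "Zset G (pext (pext x p) [e]) (pext (pext y p) [e]) \<subseteq> \<Union>(F e)" using F by blast
      also have "\<dots> \<subseteq> \<Union>(\<Union>(F ` ?I))" using e by blast
      finally show "Zset G (pext (pext x p) [e]) (pext (pext y p) [e]) \<subseteq> \<Union>(\<Union>(F ` ?I))" .
    qed
    ultimately show False using p(2) unfolding fin_def by blast
  qed
  have "fin []"
  proof (rule ccontr)
    assume nf: "\<not> fin []"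
    have "\<exists>f. \<forall>n. (length (f n) = n \<and> (pdom G x, f n) \<in> fpaths G \<and> \<not> fin (f n)) \<and>
        (\<exists>e. f (Suc n) = f n @ [e])"
    proof (rule dependent_nat_choice)
      show "\<exists>p. length p = 0 \<and> (pdom G x, p) \<in> fpaths G \<and> \<not> fin p"
        using nf xy by (auto simp: Elem_in_PG pdom_in_verts)
    next
      fix p n assume "length p = n \<and> (pdom G x, p) \<in> fpaths G \<and> \<not> fin p"
      then show "\<exists>q. (length q = Suc n \<and> (pdom G x, q) \<in> fpaths G \<and> \<not> fin q) \<and> (\<exists>e. q = p @ [e])"
        using step[of p] by (metis length_append_singleton)
    qed
    then obtain f where f: "\<And>n. length (f n) = n" "\<And>n. (pdom G x, f n) \<in> fpaths G"
      "\<And>n. \<not> fin (f n)" "\<And>n. \<exists>e. f (Suc n) = f n @ [e]"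
      by blast
    \<comment> \<open>\<open>f (Suc n)\<close> has length \<open>n + 1\<close>, so its last edge
      carries the index \<open>n\<close>.\<close>
    define t where "t n = last (f (Suc n))" for n
    have ft: "f n = map t [0..<n]" for n
    proof (induction n)
      case 0
      then show ?case using f(1)[of 0] by simp
    next
      case (Suc n)
      obtain e where "f (Suc n) = f n @ [e]" using f(4) by blast
      then show ?case using Suc by (simp add: t_def)
    qed
    have t: "t \<in> ipaths G" "head G (t 0) = pdom G x"
      using ipath_if_fpaths[of "pdom G x" t] f(2) ft by simp_all
    define g where "g = (snd x \<frown> t, int (plen y) - int (plen x), snd y \<frown> t)"
    have g: "g \<in> Zset G x y" using Zset_conc[OF xy t(1)] t(2) by (simp add: g_def)
    then obtain V where V: "V \<in> \<U>" "g \<in> V" "openin (groupoid_topology G) V" using U by blast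
    then obtain B where B: "B \<in> Zbasis G" "g \<in> B" "B \<subseteq> V"
      unfolding openin_groupoid_topology by blast
    then obtain u v where uv: "B = Zset G u v" "u \<in> fpaths G" "v \<in> fpaths G"
      unfolding Zbasis_def by blast
    \<comment> \<open>The label \<open>pext x (f n)\<close> is now at least as long as
      \<open>u\<close>, so its cylinder lies inside the basic set around \<open>g\<close> and is
      covered by \<open>V\<close> alone.\<close>
    define n where "n = plen u"
    have "t = f n \<frown> suffix n t"
      using prefix_suffix[of t n] ft[of n] by (simp add: subsequence_def)
    then have "ifactor G (snd x \<frown> t) (pext x (f n)) (suffix n t)"
      "ifactor G (snd y \<frown> t) (pext y (f n)) (suffix n t)"
      using ifactor_conc[of x t] ifactor_conc[of y t] t xy ifactor_pext
      by (auto simp: Elem_in_PG)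
    then have "g \<in> Zset G (pext x (f n)) (pext y (f n))" by (auto simp: Zset_iff g_def)
    then have "Zset G (pext x (f n)) (pext y (f n)) \<subseteq> Zset G u v"
      using Zset_subset[of g G u v "pext x (f n)" "pext y (f n)"] B uv f(1) by (simp add: n_def)
    then have "fin (f n)" using B uv V by (auto simp: fin_def intro!: exI[of _ "{V}"])
    then show False using f(3) by blast
  qed
  then show "\<exists>\<F>. finite \<F> \<and> \<F> \<subseteq> \<U> \<and> Zset G x y \<subseteq> \<Union>\<F>" by (simp add: fin_def)
qed

section \<open>The image is the ample semigroup\<close>

lemma zunion_in_ample_semigroup:
  assumes "X \<in> DP G"
  shows "zunion X \<in> ample_semigroup G"
proof -
  obtain S where S: "S \<subseteq> PG G" "finite S" "X = down_closure G S"
    using assms by (rule DP_E) blast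
  have X: "zunion X = zunion S" using S zunion_down_closure by simp
  define \<B> where "\<B> = {Zset G a b | a b. Elem a b \<in> S}"
  have eq: "zunion X = \<Union>\<B>" by (simp only: X \<B>_def zunion_def[of S])
  have "\<B> \<subseteq> (\<lambda>s. case s of Zero \<Rightarrow> {} | Elem a b \<Rightarrow> Zset G a b) ` S"
    unfolding \<B>_def by (force simp: image_iff)
  then have "finite \<B>" using S(2) finite_surj by blast
  then have "compactin (groupoid_topology G) (zunion X)"
    unfolding eq using compactin_Zset S(1) by (intro compactin_Union) (auto simp: \<B>_def)
  moreover have "\<B> \<subseteq> Zbasis G" using Zset_in_Zbasis S(1) unfolding \<B>_def by blast
  then have "openin (groupoid_topology G) (zunion X)"
    using eq unfolding openin_groupoid_topology by blast
  ultimately show ?thesis using bisection_zunion[OF assms] by (simp add: ample_semigroup_def)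
qed

lemma ample_semigroup_subset_zunion:
  assumes "A \<in> ample_semigroup G"
  shows "A \<in> zunion ` DP G"
proof -
  have A: "bisection G A" "openin (groupoid_topology G) A" "compactin (groupoid_topology G) A"
    using assms by (auto simp: ample_semigroup_def)
  obtain \<B> where B: "\<B> \<subseteq> Zbasis G" "A = \<Union>\<B>" using A(2) unfolding openin_groupoid_topology by blast
  have "\<forall>B\<in>\<B>. openin (groupoid_topology G) B"
    using B(1) unfolding groupoid_topology_def by (blast intro: topology_generated_by_Basis)
  then obtain \<C> where C: "finite \<C>" "\<C> \<subseteq> \<B>" "A \<subseteq> \<Union>\<C>"
    using A(3) B(2) unfolding compactin_def by blast
  have AC: "A = \<Union>\<C>" using B(2) C by blast
  have "\<forall>B\<in>\<C>. \<exists>s\<in>PG G. \<exists>x y. s = Elem x y \<and> B = Zset G x y"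
    using B(1) C(2) unfolding Zbasis_def Elem_in_PG Bex_def by (blast intro: Elem_in_PG[THEN iffD2])
  then obtain s where s: "\<And>B. B \<in> \<C> \<Longrightarrow> s B \<in> PG G \<and> (\<exists>x y. s B = Elem x y \<and> B = Zset G x y)"
    by metis
  \<comment> \<open>\<open>DP G\<close> asks for a nonempty generating set, but the cover may be
    empty when \<open>A\<close> is. \<open>Zero\<close> contributes no cylinder.\<close>
  define S where "S = insert Zero (s ` \<C>)"
  have S: "S \<subseteq> PG G" "finite S" "S \<noteq> {}" using s C(1) by (auto simp: S_def)
  have ZA: "Zset G a b \<subseteq> A" if ab: "(a, b) \<in> below G r" and r: "r \<in> S" for a b r
  proof -
    obtain B where B: "B \<in> \<C>" "r = s B" using r ab by (auto simp: S_def)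
    then obtain x y where "r = Elem x y" "B = Zset G x y" using s by blast
    then have "Zset G a b \<subseteq> B" using Zset_mono ab by simp
    then show ?thesis using AC B(1) by blast
  qed
  have "compatible G q r" if qr: "q \<in> S" "r \<in> S" for q r
  proof -
    \<comment> \<open>With an infinite tail at hand, two distinct paths related to the same
      \<open>c\<close> would violate injectivity on \<open>A\<close>.\<close>
    have ip: "\<exists>t\<in>ipaths G. pdom G a = head G (t 0)" if "Elem a b \<in> PG G" for a b
    proof -
      have "pdom G a \<in> verts G" using that by (simp add: Elem_in_PG pdom_in_verts)
      then show ?thesis by (metis ex_ipath)
    qed
    have P: "q \<in> PG G" "r \<in> PG G" using qr S by auto
    have "(below G q)\<inverse> O below G r \<subseteq> Id"
    proof (rule subrelI)
      fix a b assume "(a, b) \<in> (below G q)\<inverse> O below G r"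
      then obtain c where c: "(c, a) \<in> below G q" "(c, b) \<in> below G r" by blast
      then have PP: "Elem c a \<in> PG G" "Elem c b \<in> PG G" using gle_in_PG by auto
      then obtain t where "t \<in> ipaths G" "pdom G c = head G (t 0)" using ip by blast
      then have "a = b" using bisection_Zset_cancel'[OF A(1) PP] ZA c qr by blast
      then show "(a, b) \<in> Id" by simp
    qed
    moreover have "below G q O (below G r)\<inverse> \<subseteq> Id"
    proof (rule subrelI)
      fix a b assume "(a, b) \<in> below G q O (below G r)\<inverse>"
      then obtain c where c: "(a, c) \<in> below G q" "(b, c) \<in> below G r" by blast
      then have PP: "Elem a c \<in> PG G" "Elem b c \<in> PG G" using gle_in_PG by auto
      then obtain t where "t \<in> ipaths G" "pdom G a = head G (t 0)" using ip by blast
      then have "a = b" using bisection_Zset_cancel[OF A(1) PP] ZA c qr by blast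
      then show "(a, b) \<in> Id" by simp
    qed
    ultimately show ?thesis using compatible_iff_below[OF P] by blast
  qed
  then have "down_closure G S \<in> DP G" using S unfolding DP_def by blast
  moreover have "zunion (down_closure G S) = A"
    unfolding zunion_down_closure[OF S(1)]
  proof (intro equalityI subsetI)
    fix g assume "g \<in> zunion S"
    then obtain a b where ab: "Elem a b \<in> S" "g \<in> Zset G a b" by (rule zunionE)
    then have "(a, b) \<in> below G (Elem a b)" using S(1) gle_refl by auto
    then show "g \<in> A" using ZA[of a b "Elem a b"] ab by blast
  next
    fix g assume "g \<in> A"
    then obtain B where B: "B \<in> \<C>" "g \<in> B" using AC by blast
    then obtain x y where "s B = Elem x y" "B = Zset G x y" using s by blast
    moreover have "s B \<in> S" using B(1) by (simp add: S_def)
    ultimately show "g \<in> zunion S" using B(2) zunionI[of g x y S] by simp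
  qed
  ultimately show ?thesis by blast
qed

lemma zunion_DP: "zunion ` DP G = ample_semigroup G"
  using zunion_in_ample_semigroup ample_semigroup_subset_zunion by blast

section \<open>The kernel is \<open>CK_rel G\<close>\<close>

lemma zunion_subset_imp_arrow:
  assumes A: "A \<subseteq> PG G" and B: "B \<subseteq> PG G" and sub: "zunion A \<subseteq> zunion B"
  shows "arrow G A B"
  unfolding arrow_def
proof (intro ballI allI impI)
  fix a s assume a: "a \<in> A" and s: "s \<noteq> Zero \<and> gle G s a"
  obtain x y where xy: "s = Elem x y" using s by (cases s) auto
  obtain u v where uv: "a = Elem u v" using s by (cases a) auto
  have P: "Elem x y \<in> PG G" using s xy gle_in_PG by blast
  obtain g where g: "g \<in> Zset G x y" using Zset_nonempty[OF P] by blast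
  then have "g \<in> zunion A" using s xy uv a Zset_mono zunionI by blast
  then obtain b c where bc: "Elem b c \<in> B" "g \<in> Zset G b c" using sub zunionE by blast
  then have "Elem b c \<in> PG G" using B by blast
  then have "gmeet G s (Elem b c) \<noteq> Zero"
    using comparable_if_Zset_meet[OF g bc(2) P] gmeet_nonzero_iff[of s "Elem b c"] P xy by simp
  then show "\<exists>b\<in>B. gmeet G s b \<noteq> Zero" using bc(1) by blast
qed

lemma zunion_eq_empty_iff:
  assumes "X \<in> DP G"
  shows "zunion X = {} \<longleftrightarrow> X = {Zero}"
proof
  assume e: "zunion X = {}"
  have "s = Zero" if s: "s \<in> X" for s
  proof (cases s)
    case (Elem x y)
    then have "Elem x y \<in> PG G" using s DP_subset_PG[OF assms] by blast
    then obtain g where "g \<in> Zset G x y" using Zset_nonempty by blast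
    then show ?thesis using e zunionI[of g x y X] s Elem by blast
  qed
  then show "X = {Zero}" using Zero_in_DP[OF assms] by blast
next
  assume "X = {Zero}"
  then show "zunion X = {}" by (auto elim: zunionE)
qed

lemma CK_rel_eq: "CK_rel G = {(X, Y). X \<in> DP G \<and> Y \<in> DP G \<and> zunion X = zunion Y}"
proof -
  have *: "arrow G (orth_gens G X) (orth_gens G Y) \<longleftrightarrow> zunion X \<subseteq> zunion Y"
    if "X \<in> DP G" "X \<noteq> {Zero}" "Y \<in> DP G" "Y \<noteq> {Zero}" for X Y
  proof -
    note X = orth_gens_props[OF that(1,2)] and Y = orth_gens_props[OF that(3,4)]
    have PG: "orth_gens G X \<subseteq> PG G" "orth_gens G Y \<subseteq> PG G" using X(2) Y(2) by auto
    have "zunion X = zunion (orth_gens G X)" "zunion Y = zunion (orth_gens G Y)"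
      using zunion_down_closure[OF PG(1)] zunion_down_closure[OF PG(2)] X(3) Y(3) by simp_all
    then show ?thesis
      using zunion_subset_imp_arrow[OF PG] arrow_imp_zunion_subset[OF PG(1) Y(2,1)] by blast
  qed
  have "(X, Y) \<in> CK_rel G \<longleftrightarrow> X \<in> DP G \<and> Y \<in> DP G \<and> zunion X = zunion Y" for X Y
    using *[of X Y] *[of Y X] zunion_eq_empty_iff[of X] zunion_eq_empty_iff[of Y]
    unfolding CK_rel_def by blast
  then show ?thesis by auto
qed

end

text \<open>As \<open>r\<close> is the kernel of \<open>F\<close>, its classes are the fibres of
  \<open>F\<close>. By \<open>hom\<close>, the fibre containing \<open>m X Y\<close> depends only on
  \<open>F X\<close> and \<open>F Y\<close>, which makes the product of classes well
  defined.\<close>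

lemma semigroup_isomorphic_quotient:
  assumes closed: "\<And>X Y. X \<in> D \<Longrightarrow> Y \<in> D \<Longrightarrow> m X Y \<in> D"
    and hom: "\<And>X Y. X \<in> D \<Longrightarrow> Y \<in> D \<Longrightarrow> F (m X Y) = n (F X) (F Y)"
    and surj: "F ` D = T"
    and r: "r = {(X, Y). X \<in> D \<and> Y \<in> D \<and> F X = F Y}"
  shows "semigroup_isomorphic (D // r) (\<lambda>C C'. \<Union>X\<in>C. \<Union>Y\<in>C'. r `` {m X Y}) T n"
proof -
  define cls where "cls b = {X \<in> D. F X = b}" for b
  have cls: "r `` {X} = cls (F X)" if "X \<in> D" for X
    using that by (auto simp: r cls_def)
  have quot: "D // r = cls ` T"
    unfolding quotient_def surj[symmetric] using cls by auto
  have inj: "inj_on cls T"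
    unfolding surj[symmetric] by (rule inj_onI) (auto simp: cls_def)
  \<comment> \<open>Every term of the double union is the same fibre, and surjectivity guarantees
    that there is at least one term.\<close>
  have mult: "(\<Union>X\<in>cls a. \<Union>Y\<in>cls b. r `` {m X Y}) = cls (n a b)" if ab: "a \<in> T" "b \<in> T" for a b
  proof -
    obtain X Y where "X \<in> cls a" "Y \<in> cls b" using ab surj by (auto simp: cls_def)
    moreover have "r `` {m X Y} = cls (n a b)" if "X \<in> cls a" "Y \<in> cls b" for X Y
      using that cls[OF closed, of X Y] hom[of X Y] by (auto simp: cls_def)
    ultimately show ?thesis by blast
  qed
  have nT: "n a b \<in> T" if "a \<in> T" "b \<in> T" for a b
    using that unfolding surj[symmetric] by (auto simp: hom[symmetric] closed)
  define \<phi> where "\<phi> = the_inv_into T cls"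
  have \<phi>: "\<phi> (cls a) = a" if "a \<in> T" for a
    using the_inv_into_f_f[OF inj that] by (simp add: \<phi>_def)
  have "bij_betw \<phi> (D // r) T"
    unfolding \<phi>_def quot by (intro bij_betw_the_inv_into inj_on_imp_bij_betw inj)
  moreover have "\<forall>C\<in>D // r. \<forall>C'\<in>D // r. \<phi> (\<Union>X\<in>C. \<Union>Y\<in>C'. r `` {m X Y}) = n (\<phi> C) (\<phi> C')"
  proof (intro ballI)
    fix C C' assume "C \<in> D // r" "C' \<in> D // r"
    then obtain a b where "a \<in> T" "b \<in> T" "C = cls a" "C' = cls b" unfolding quot by blast
    then show "\<phi> (\<Union>X\<in>C. \<Union>Y\<in>C'. r `` {m X Y}) = n (\<phi> C) (\<phi> C')"
      by (simp only: mult \<phi> nT)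
  qed
  ultimately show ?thesis unfolding semigroup_isomorphic_def by blast
qed

theorem theorem3p22:
  fixes G :: "('v, 'e) pre_digraph"
  assumes "wf_digraph G"
    and "\<And>v. v \<in> verts G \<Longrightarrow> finite (in_arcs G v) \<and> 2 \<le> in_degree G v"
  shows "semigroup_isomorphic (CK G) (CK_mult G) (ample_semigroup G) gpd_set_mult"
proof -
  interpret wf_digraph G by fact
  interpret row_finite_digraph G
    using assms(2) by unfold_locales (force simp: in_degree_def)+
  have "CK_mult G = (\<lambda>C C'. \<Union>X\<in>C. \<Union>Y\<in>C'. CK_rel G `` {DP_mult G X Y})"
    by (intro ext) (simp add: CK_mult_def)
  then show ?thesis
    unfolding CK_def
    using semigroup_isomorphic_quotient[of "DP G" "DP_mult G" zunion gpd_set_mult, OF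
        DP_mult_in_DP zunion_DP_mult zunion_DP CK_rel_eq]
    by simp
qed

end
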